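(* Assume the Continuum Hypothesis. Then there are countably tight, zero-dimensional Hausdorff spaces $X_1,X_2,X_3,X_4$ such that (1) $X_1$ is fin-SP but not $1$-SP; (2) $X_2$ is $ClScat$-SP but not fin-SP; (3) $X_3$ is $Scat$-SP but not $ClScat$-SP; (4) $X_4$ is pseudocompact but not $Nwd$-SP.
   Context: For a topological space $X$ and $\mathcal A\subseteq\mathcal P(X)$, $X$ is called $\mathcal A$-selectively pseudocompact ($\mathcal A$-SP) if for every sequence $\langle U_n:n\in\omega\rangle$ of pairwise disjoint non-empty open subsets of $X$ one can choose sets $A_n\in\mathcal A$ with $A_n\subseteq U_n$ such that the family $\{A_n:n\in\omega\}$ has an accumulation point, i.e. there is a point $x\in X$ every neighbourhood of which meets $A_n$ for infinitely many $n$. Then: $X$ is $1$-SP if it is $[X]^1$-SP (i.e. singletons are chosen; this is selective pseudocompactness); $X$ is fin-SP if it is $[X]^{<\omega}$-SP (finite subsets); $X$ is $ClScat$-SP if it is $\mathcal A$-SP for $\mathcal A$ the family of closed scattered subsets of $X$; $X$ is $Scat$-SP if $\mathcal A$ is the family of scattered subsets of $X$; $X$ is $Nwd$-SP if $\mathcal A$ is the family of nowhere dense subsets of $X$. A set is scattered if each of its non-empty subsets has a point isolated in that subset. *)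

theory Defs
  imports "HOL-Analysis.Analysis" "HOL-Library.Equipollence"
begin

definition CH :: bool where
  "CH \<longleftrightarrow> (\<forall>A :: real set. countable A \<or> A \<approx> (UNIV :: real set))"

definition countably_tight :: "'a topology \<Rightarrow> bool" where
  "countably_tight X \<longleftrightarrow>
     (\<forall>A x. A \<subseteq> topspace X \<and> x \<in> X closure_of A \<longrightarrow>
        (\<exists>B. B \<subseteq> A \<and> countable B \<and> x \<in> X closure_of B))"

definition accumulation_point_of_seq :: "'a topology \<Rightarrow> (nat \<Rightarrow> 'a set) \<Rightarrow> 'a \<Rightarrow> bool" where
  "accumulation_point_of_seq X A x \<longleftrightarrow>
     x \<in> topspace X \<and>
     (\<forall>U. openin X U \<and> x \<in> U \<longrightarrow> infinite {n. U \<inter> A n \<noteq> {}})"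

definition selectively_pseudocompact_wrt :: "'a topology \<Rightarrow> 'a set set \<Rightarrow> bool" where
  "selectively_pseudocompact_wrt X \<AA> \<longleftrightarrow>
     (\<forall>U :: nat \<Rightarrow> 'a set.
        (\<forall>n. openin X (U n) \<and> U n \<noteq> {}) \<and> (\<forall>m n. m \<noteq> n \<longrightarrow> U m \<inter> U n = {}) \<longrightarrow>
        (\<exists>A :: nat \<Rightarrow> 'a set. (\<forall>n. A n \<in> \<AA> \<and> A n \<subseteq> U n) \<and>
            (\<exists>x. accumulation_point_of_seq X A x)))"

definition scattered_set :: "'a topology \<Rightarrow> 'a set \<Rightarrow> bool" where
  "scattered_set X S \<longleftrightarrow> S \<subseteq> topspace X \<and>
     (\<forall>T. T \<subseteq> S \<and> T \<noteq> {} \<longrightarrow>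
        (\<exists>t\<in>T. \<exists>U. openin X U \<and> U \<inter> T = {t}))"

definition nowhere_dense_in :: "'a topology \<Rightarrow> 'a set \<Rightarrow> bool" where
  "nowhere_dense_in X S \<longleftrightarrow> S \<subseteq> topspace X \<and> X interior_of (X closure_of S) = {}"

definition one_SP :: "'a topology \<Rightarrow> bool" where
  "one_SP X \<longleftrightarrow> selectively_pseudocompact_wrt X {A. A \<subseteq> topspace X \<and> card A = 1}"

definition fin_SP :: "'a topology \<Rightarrow> bool" where
  "fin_SP X \<longleftrightarrow> selectively_pseudocompact_wrt X {A. A \<subseteq> topspace X \<and> finite A}"

definition ClScat_SP :: "'a topology \<Rightarrow> bool" where
  "ClScat_SP X \<longleftrightarrow> selectively_pseudocompact_wrt X {A. closedin X A \<and> scattered_set X A}"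

definition Scat_SP :: "'a topology \<Rightarrow> bool" where
  "Scat_SP X \<longleftrightarrow> selectively_pseudocompact_wrt X {A. scattered_set X A}"

definition Nwd_SP :: "'a topology \<Rightarrow> bool" where
  "Nwd_SP X \<longleftrightarrow> selectively_pseudocompact_wrt X {A. nowhere_dense_in X A}"

definition pseudocompact :: "'a topology \<Rightarrow> bool" where
  "pseudocompact X \<longleftrightarrow>
     (\<forall>f. continuous_map X euclideanreal f \<longrightarrow> bounded (f ` topspace X))"

definition nice_space :: "'a topology \<Rightarrow> bool" where
  "nice_space X \<longleftrightarrow> countably_tight X \<and> X dim_le 0 \<and> Hausdorff_space X"

end

theory Submission
  imports Defs
begin

text \<open>
  All four spaces have the form \<open>X = D \<union> P\<close>, where \<open>D\<close> is the open topological sum of countably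
  many Cantor sets (the columns) and the points of \<open>P\<close> are indexed by the reals, well-ordered in
  type \<open>\<omega>\<^sub>1\<close>. A point \<open>a\<close> of \<open>P\<close> is a function on the reals; its neighbourhoods prescribe
  finitely many coordinates, coordinate \<open>g\<close> meeting \<open>D\<close> in a columnwise clopen set \<open>Z g\<close>.
  The matrix of values is built column by column by transfinite recursion, as for HFD spaces.
  Every \<open>a\<close> is an accumulation point of some set that is large in infinitely many columns, and this is
  kept as a promise; at each stage a selection of small closed sets, one in each column, is
  separated from one point of \<open>P\<close>; and every countably infinite subset of \<open>P\<close> is finally
  dense, which makes \<open>X\<close> countably tight.
  A set that is large by a margin stays large after removal of a clopen neighbourhood of a small
  closed set. The four spaces correspond to four pairs (large, small): large cardinality and
  singletons, large Cantor--Bendixson rank and finite sets, non-scattered closure and closed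
  scattered sets, somewhere dense and nowhere dense sets.
\<close>

section \<open>Preliminary combinatorics\<close>

text \<open>The continuum hypothesis leaves only countably many promises, patterns and earlier
  coordinates to respect at each stage, and a single new clopen trace can respect countably many.
  All tasks must therefore be coded by reals. A column has too many subsets for that; so only
  selections of finitely supported points are realised, and the avoided small sets are closed: both
  are then described by sets of finite words. Largeness is graded because large sets in a single
  column need not survive splitting or avoidance at full strength; the loss is absorbed by columns
  of ever higher grade. Final density serves countable tightness as for HFD spaces: agreement with a
  point on finite subsets of a countable set of coordinates is arranged by closing off, and finitely
  many coordinates outside that set can be prescribed at will.\<close>

lemma distinct_representatives:
  fixes R :: "nat \<Rightarrow> 'a set"
  assumes "\<And>k. infinite (R k)"
  obtains x where "inj x" "\<And>k. x k \<in> R k"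
proof -
  have "\<exists>x. \<forall>k. x k \<in> R k \<and> x k \<notin> x ` {..<k}"
  proof (rule dependent_wf_choice[OF wf_less_than, where P = "\<lambda>f k y. y \<in> R k \<and> y \<notin> f ` {..<k}"])
    fix f g :: "nat \<Rightarrow> 'a" and k y
    assume "\<And>z. (z, k) \<in> less_than \<Longrightarrow> f z = g z"
    then have "f ` {..<k} = g ` {..<k}" by (intro image_cong) auto
    then show "(y \<in> R k \<and> y \<notin> f ` {..<k}) = (y \<in> R k \<and> y \<notin> g ` {..<k})" by simp
  next
    fix k and f :: "nat \<Rightarrow> 'a"
    have "infinite (R k - f ` {..<k})" using assms by simp
    then show "\<exists>y. y \<in> R k \<and> y \<notin> f ` {..<k}" by (metis DiffD1 DiffD2 finite.emptyI equals0I)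
  qed
  then obtain x where x: "\<And>k. x k \<in> R k" "\<And>k. x k \<notin> x ` {..<k}" by blast
  have "inj x"
    by (rule linorder_injI) (metis x(2) imageI lessThan_iff)
  with x(1) show thesis using that by blast
qed

text \<open>Supplies the values of the existing points at a new coordinate: two of them are
  dictated, and every infinite set on a countable list is cut into two infinite halves.\<close>

lemma splitting_predicate:
  fixes F :: "'a set set"
  assumes "countable F" "\<And>Q. Q \<in> F \<Longrightarrow> infinite Q"
  obtains e where "e a" "a \<noteq> b \<Longrightarrow> \<not> e b"
    "\<And>Q c. Q \<in> F \<Longrightarrow> infinite {q \<in> Q. e q = c}"
proof (cases "F = {}")
  case True
  then show thesis using that[of "\<lambda>x. x = a"] by simp
next
  case False
  define Q where "Q = from_nat_into F"
  \<comment> \<open>Each member of \<open>F\<close> recurs for infinitely many \<open>k\<close>.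
    Removing \<open>a\<close> and \<open>b\<close> keeps their values free for the first two
    claims.\<close>
  define R where "R = (\<lambda>k. Q (fst (prod_decode k)) - {a, b})"
  have "infinite (R k)" for k
    using False assms by (simp add: R_def Q_def from_nat_into)
  then obtain x where x: "inj x" "\<And>k. x k \<in> R k" using distinct_representatives[of R] by blast
  define e where "e y \<longleftrightarrow> y = a \<or> (\<exists>k. y = x k \<and> even (snd (prod_decode k)))" for y
  have ex: "e (x k) \<longleftrightarrow> even (snd (prod_decode k))" for k
  proof -
    have "x k \<noteq> a" using x(2)[of k] by (auto simp: R_def)
    then show ?thesis using x(1) by (auto simp: e_def dest: injD)
  qed
  show thesis
  proof (rule that[of e])
    show "e a" by (simp add: e_def)
    show "\<not> e b" if "a \<noteq> b"
    proof -
      have "x k \<noteq> b" for k using x(2)[of k] by (auto simp: R_def)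
      then show ?thesis using that by (auto simp: e_def)
    qed
    fix S c assume "S \<in> F"
    then obtain i where i: "S = Q i"
      unfolding Q_def using from_nat_into_surj[OF assms(1)] by blast
    define y where "y j = x (prod_encode (i, 2 * j + (if c then 0 else 1)))" for j
    have "inj y"
      by (rule injI) (use x(1) in \<open>auto simp: y_def dest!: injD split: if_splits\<close>)
    moreover have "range y \<subseteq> {q \<in> S. e q = c}"
    proof
      fix w assume "w \<in> range y"
      then obtain j where w: "w = x (prod_encode (i, 2 * j + (if c then 0 else 1)))" by (auto simp: y_def)
      have "w \<in> S" using x(2)[of "prod_encode (i, 2 * j + (if c then 0 else 1))"]
        by (simp add: w R_def i)
      moreover have "e w = c" unfolding w ex by simp
      ultimately show "w \<in> {q \<in> S. e q = c}" by simp
    qed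
    ultimately show "infinite {q \<in> S. e q = c}"
      by (meson finite_subset range_inj_infinite)
  qed
qed

text \<open>A descending sequence of big sets decides the sets \<open>Z i\<close> one after another,
  and \<open>v i\<close> records the side. It is used with \<open>large\<close> to place a new point
  at the earlier coordinates, and with \<open>infinite\<close> for the compactness of the Cantor
  set.\<close>

lemma coherent_choice:
  fixes Z :: "'i \<Rightarrow> 'a set" and big :: "'a set \<Rightarrow> bool"
  assumes "countable I" "big L"
    and split: "\<And>M N. big M \<Longrightarrow> big (M \<inter> N) \<or> big (M - N)"
    and mono: "\<And>M N. big M \<Longrightarrow> M \<subseteq> N \<Longrightarrow> big N"
    and nonempty: "\<not> big {}"
  shows "\<exists>v. \<forall>s. finite s \<and> s \<subseteq> I \<longrightarrow> big {x \<in> L. \<forall>i\<in>s. (x \<in> Z i) = v i}"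
proof (cases "I = {}")
  case True
  with \<open>big L\<close> show ?thesis by simp
next
  case False
  define g where "g = from_nat_into I"
  define M where "M = rec_nat L (\<lambda>n K. if big (K \<inter> Z (g n)) then K \<inter> Z (g n) else K - Z (g n))"
  have M0: "M 0 = L"
    and MS: "\<And>n. M (Suc n) = (if big (M n \<inter> Z (g n)) then M n \<inter> Z (g n) else M n - Z (g n))"
    by (simp_all add: M_def)
  have big: "big (M n)" for n
    by (induction n) (use assms(2) split in \<open>auto simp: M0 MS\<close>)
  have dec: "M n \<subseteq> M m" if "m \<le> n" for m n
    using that by (induction rule: dec_induct) (auto simp: MS)
  define v where "v i \<longleftrightarrow> (\<exists>n. M n \<subseteq> Z i)" for i
  have ex: "\<exists>n. \<forall>x\<in>M n. (x \<in> Z i) = v i" if "i \<in> I" for i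
  proof -
    obtain n where n: "g n = i" unfolding g_def
      using from_nat_into_surj[OF assms(1) \<open>i \<in> I\<close>] by blast
    show ?thesis
    proof (cases "big (M n \<inter> Z i)")
      case True
      then have "M (Suc n) \<subseteq> Z i" by (simp add: MS n)
      then show ?thesis unfolding v_def by blast
    next
      case F: False
      then have D: "M (Suc n) \<inter> Z i = {}" by (auto simp: MS n)
      \<comment> \<open>Otherwise the later of two stages, one inside \<open>Z i\<close> and one
        disjoint from it, would be both big and empty.\<close>
      have "\<not> v i"
      proof
        assume "v i"
        then obtain m where "M m \<subseteq> Z i" by (auto simp: v_def)
        then have "M (max m (Suc n)) \<subseteq> {}"
          using dec[of m "max m (Suc n)"] dec[of "Suc n" "max m (Suc n)"] D by auto
        then show False using big nonempty by (metis subset_empty)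
      qed
      then show ?thesis using D by blast
    qed
  qed
  show ?thesis
  proof (intro exI[of _ v] allI impI)
    fix s assume "finite s \<and> s \<subseteq> I"
    then have s: "finite s" "s \<subseteq> I" by auto
    then have "\<exists>n. M n \<subseteq> {x \<in> L. \<forall>i\<in>s. (x \<in> Z i) = v i}"
    proof (induction s)
      case empty
      then show ?case using M0 by auto
    next
      case (insert i s)
      then obtain n where n: "M n \<subseteq> {x \<in> L. \<forall>i\<in>s. (x \<in> Z i) = v i}" by auto
      obtain m where m: "\<forall>x\<in>M m. (x \<in> Z i) = v i" using ex[of i] insert.prems by auto
      have "M (max m n) \<subseteq> {x \<in> L. \<forall>i\<in>insert i s. (x \<in> Z i) = v i}"
        using n m dec[of m "max m n"] dec[of n "max m n"] by auto
      then show ?case by blast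
    qed
    then show "big {x \<in> L. \<forall>i\<in>s. (x \<in> Z i) = v i}" using big mono by blast
  qed
qed

section \<open>The Cantor set and notions of largeness\<close>

definition agree :: "nat \<Rightarrow> (nat \<Rightarrow> bool) \<Rightarrow> (nat \<Rightarrow> bool) \<Rightarrow> bool" where
  "agree k t u \<longleftrightarrow> (\<forall>i<k. t i = u i)"

text \<open>By compactness of the Cantor set, one level \<open>k\<close> for all points yields
  exactly the topologically clopen sets.\<close>

definition clopen :: "(nat \<Rightarrow> bool) set \<Rightarrow> bool" where
  "clopen Z \<longleftrightarrow> (\<exists>k. \<forall>t u. agree k t u \<longrightarrow> (t \<in> Z \<longleftrightarrow> u \<in> Z))"

definition cantor_closed :: "(nat \<Rightarrow> bool) set \<Rightarrow> bool" where
  "cantor_closed S \<longleftrightarrow> (\<forall>t. (\<forall>k. \<exists>u\<in>S. agree k t u) \<longrightarrow> t \<in> S)"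

lemma agree_refl [simp]: "agree k t t"
  by (simp add: agree_def)

lemma agree_sym: "agree k t u \<Longrightarrow> agree k u t"
  by (simp add: agree_def)

lemma agree_trans: "agree k t u \<Longrightarrow> agree k u w \<Longrightarrow> agree k t w"
  by (simp add: agree_def)

lemma agree_mono: "agree k t u \<Longrightarrow> j \<le> k \<Longrightarrow> agree j t u"
  by (simp add: agree_def)

lemma agree_all_imp_eq: "(\<And>k. agree k t u) \<Longrightarrow> t = u"
  by (auto simp: agree_def)

lemma clopen_agree [simp, intro]: "clopen {u. agree k t u}"
  unfolding clopen_def using agree_trans agree_sym by blast

lemma clopen_empty [simp, intro]: "clopen {}"
  by (simp add: clopen_def)

text \<open>Splitting may halve the grade and avoiding a small set may cost one. Non-emptiness is
  demanded from grade one on, since grade zero may hold of the empty set, as it does for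
  cardinality.\<close>

locale largeness =
  fixes Lg :: "nat \<Rightarrow> (nat \<Rightarrow> bool) set \<Rightarrow> bool" and small :: "(nat \<Rightarrow> bool) set \<Rightarrow> bool"
  assumes Lg_mono: "Lg r A \<Longrightarrow> A \<subseteq> B \<Longrightarrow> Lg r B"
    and Lg_Suc: "Lg (Suc r) A \<Longrightarrow> Lg r A"
    and Lg_nonempty: "Lg (Suc r) A \<Longrightarrow> A \<noteq> {}"
    and Lg_split: "Lg (r + r) A \<Longrightarrow> Lg r (A \<inter> B) \<or> Lg r (A - B)"
    and Lg_avoid: "small S \<Longrightarrow> Lg (Suc r) A \<Longrightarrow> \<exists>Z. clopen Z \<and> Z \<inter> S = {} \<and> Lg r (A \<inter> Z)"
    and Lg_UNIV: "Lg r UNIV"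
    and small_empty: "small {}"
begin

lemma Lg_le: "Lg r A \<Longrightarrow> q \<le> r \<Longrightarrow> Lg q A"
  by (induction r) (auto simp: le_Suc_eq dest: Lg_Suc)

text \<open>High grades in arbitrarily late columns: this makes the graded losses disappear, so that
  the sets that are not large form an ideal.\<close>

definition large :: "(nat \<times> (nat \<Rightarrow> bool)) set \<Rightarrow> bool" where
  "large L \<longleftrightarrow> (\<forall>r m. \<exists>n\<ge>m. Lg r (L `` {n}))"

lemma large_mono: "large L \<Longrightarrow> L \<subseteq> M \<Longrightarrow> large M"
  unfolding large_def by (meson Image_mono Lg_mono order_refl)

lemma large_empty: "\<not> large {}"
  using Lg_nonempty[of 0 "{}"] by (auto simp: large_def)

lemma large_UNIV: "large UNIV"
  unfolding large_def using Lg_UNIV by (metis Lg_mono Image_singleton_iff UNIV_I order_refl subsetI)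

lemma large_split:
  assumes "large L"
  shows "large (L \<inter> M) \<or> large (L - M)"
proof (rule ccontr)
  assume "\<not> ?thesis"
  then obtain r m r' m' where
    1: "\<And>n. n \<ge> m \<Longrightarrow> \<not> Lg r ((L \<inter> M) `` {n})" and
    2: "\<And>n. n \<ge> m' \<Longrightarrow> \<not> Lg r' ((L - M) `` {n})"
    unfolding large_def by metis
  define R where "R = max r r'"
  obtain n where n: "n \<ge> max m m'" "Lg (R + R) (L `` {n})"
    using assms unfolding large_def by blast
  have "(L \<inter> M) `` {n} = L `` {n} \<inter> M `` {n}" "(L - M) `` {n} = L `` {n} - M `` {n}" by auto
  then have "Lg R ((L \<inter> M) `` {n}) \<or> Lg R ((L - M) `` {n})"
    using Lg_split[OF n(2)] by auto
  then show False using 1[of n] 2[of n] n(1) Lg_le by (auto simp: R_def)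
qed

text \<open>Only one column is spent on each requirement, so the requirements never interact.\<close>

lemma fusion:
  fixes T :: "nat \<Rightarrow> (nat \<Rightarrow> bool) set" and F :: "'a set" and L :: "'a \<Rightarrow> (nat \<times> (nat \<Rightarrow> bool)) set"
  assumes "countable F" "\<And>k. k \<in> F \<Longrightarrow> large (L k)" "\<And>n. small (T n)"
  obtains z where "\<And>n. clopen (z `` {n})" "\<And>n. z `` {n} \<inter> T n = {}"
    "\<And>k. k \<in> F \<Longrightarrow> large {x \<in> L k. (x \<in> z) = b k}"
proof (cases "F = {}")
  case True
  then show thesis using that[of "{}"] by simp
next
  case False
  define g where "g = from_nat_into F"
  \<comment> \<open>The number \<open>j\<close> codes one requirement: a member of \<open>F\<close>,
    a grade to be kept and a bound that the column has to exceed or equal.\<close>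
  define K where "K j = g (fst (prod_decode j))" for j
  define r where "r j = fst (prod_decode (snd (prod_decode j)))" for j
  define m where "m j = snd (prod_decode (snd (prod_decode j)))" for j
  \<comment> \<open>The extra grade is what avoiding \<open>T (c j)\<close> will cost.\<close>
  define R where "R j = {n. m j \<le> n \<and> Lg (Suc (r j)) (L (K j) `` {n})}" for j
  have "infinite (R j)" for j
  proof -
    have "large (L (K j))"
      using False assms(2) by (simp add: K_def g_def from_nat_into)
    then have "\<exists>n>M. n \<in> R j" for M
      unfolding large_def R_def by (metis (mono_tags, lifting) Suc_le_eq le_max_iff_disj max.bounded_iff mem_Collect_eq)
    then show ?thesis by (meson infinite_nat_iff_unbounded)
  qed
  then obtain c where c: "inj c" "\<And>j. c j \<in> R j" using distinct_representatives[of R] by blast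
  have "\<exists>Z. clopen Z \<and> Z \<inter> T (c j) = {} \<and> Lg (r j) (L (K j) `` {c j} \<inter> Z)" for j
    using c(2)[of j] Lg_avoid[OF assms(3)[of "c j"]] by (auto simp: R_def)
  then obtain Z where Z: "\<And>j. clopen (Z j)" "\<And>j. Z j \<inter> T (c j) = {}"
    "\<And>j. Lg (r j) (L (K j) `` {c j} \<inter> Z j)" by metis
  \<comment> \<open>If the side asked for is the complement, \<open>z\<close> is left empty in that
    column and the whole section of \<open>L (K j)\<close> survives. Columns without a requirement
    are left empty as well, so nothing has to be avoided there.\<close>
  define z where "z = {(n, u). \<exists>j. n = c j \<and> b (K j) \<and> u \<in> Z j}"
  have zc: "z `` {c j} = (if b (K j) then Z j else {})" for j
    using c(1) by (auto simp: z_def dest: injD)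
  have z0: "z `` {n} = {}" if "n \<notin> range c" for n
    using that by (auto simp: z_def)
  show thesis
  proof (rule that[of z])
    show "clopen (z `` {n})" for n
      by (cases "n \<in> range c") (auto simp: zc z0 Z(1) simp del: Image_singleton_iff)
    show "z `` {n} \<inter> T n = {}" for n
    proof (cases "n \<in> range c")
      case True
      then obtain j where "n = c j" by blast
      then show ?thesis using zc[of j] Z(2)[of j] by (simp split: if_splits)
    qed (metis z0 Int_empty_left)
    fix k assume k: "k \<in> F"
    show "large {x \<in> L k. (x \<in> z) = b k}"
      unfolding large_def
    proof (intro allI)
      fix q M
      obtain i where i: "g i = k" unfolding g_def
        using from_nat_into_surj[OF assms(1) k] by blast
      define j where "j = prod_encode (i, prod_encode (q, M))"
      have j: "K j = k" "r j = q" "m j = M" by (simp_all add: j_def K_def r_def m_def i)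
      have "M \<le> c j" using c(2)[of j] by (simp add: R_def j)
      moreover have "L k `` {c j} \<inter> Z j \<subseteq> {x \<in> L k. (x \<in> z) = b k} `` {c j}"
      proof (cases "b k")
        case True
        then show ?thesis using zc[of j] by (auto simp: j)
      next
        case False
        then show ?thesis using zc[of j] by (auto simp: j)
      qed
      ultimately show "\<exists>n\<ge>M. Lg q ({x \<in> L k. (x \<in> z) = b k} `` {n})"
        using Z(3)[of j] Lg_mono unfolding j by blast
    qed
  qed
qed

end

section \<open>The transfinite construction\<close>

locale omega1_order =
  fixes lt :: "real \<Rightarrow> real \<Rightarrow> bool" (infix "\<sqsubset>" 50)
  assumes wf_lt: "wf {(x, y). x \<sqsubset> y}"
    and lt_trans: "x \<sqsubset> y \<Longrightarrow> y \<sqsubset> z \<Longrightarrow> x \<sqsubset> z"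
    and lt_total: "x \<sqsubset> y \<or> x = y \<or> y \<sqsubset> x"
    and countable_lt: "countable {x. x \<sqsubset> y}"
begin

lemma lt_irrefl [simp]: "\<not> x \<sqsubset> x"
  using wf_lt by (auto dest: wf_not_refl)

lemma lt_asym: "x \<sqsubset> y \<Longrightarrow> \<not> y \<sqsubset> x"
  using lt_trans lt_irrefl by blast

definition upto :: "real \<Rightarrow> real set" where
  "upto x = insert x {y. y \<sqsubset> x}"

lemma countable_upto: "countable (upto x)"
  by (simp add: upto_def countable_lt)

lemma upto_iff: "x \<in> upto y \<longleftrightarrow> \<not> y \<sqsubset> x"
  using lt_total lt_asym by (auto simp: upto_def)

lemma finite_has_max:
  assumes "finite s" "s \<noteq> {}"
  shows "\<exists>m\<in>s. s \<subseteq> upto m"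
  using assms
proof (induction s rule: finite_ne_induct)
  case (singleton x)
  then show ?case by (simp add: upto_def)
next
  case (insert x s)
  then obtain m where m: "m \<in> s" "s \<subseteq> upto m" by blast
  show ?case
  proof (cases "m \<sqsubset> x")
    case True
    then have "s \<subseteq> upto x" using m by (auto simp: upto_def dest: lt_trans)
    then show ?thesis by (auto simp: upto_def)
  next
    case False
    then show ?thesis using m by (auto simp: upto_iff)
  qed
qed

text \<open>Initial segments are countable, so countably many of them cannot cover \<open>B\<close>.
  In the application to codes, \<open>B\<close> consists of the many codes of one requirement, of
  which one has to lie late enough.\<close>

lemma countable_bounded:
  assumes "countable K" "uncountable B"
  shows "\<exists>b\<in>B. \<forall>k\<in>K. k \<sqsubset> b"
proof -
  have "countable (\<Union>k\<in>K. upto k)" using assms(1) countable_upto by blast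
  then have "\<not> B \<subseteq> (\<Union>k\<in>K. upto k)"
    using assms(2) countable_subset by blast
  then obtain b where "b \<in> B" "b \<notin> (\<Union>k\<in>K. upto k)" by blast
  moreover from this have "\<forall>k\<in>K. k \<sqsubset> b" by (simp add: upto_iff)
  ultimately show ?thesis by blast
qed

end

text \<open>The bookkeeping: \<open>A a\<close> is the set at which point \<open>a\<close> must
  accumulate, \<open>T g\<close> the selection avoided by coordinate \<open>g\<close>,
  \<open>b g\<close> and \<open>b' g\<close> the points given the values true and false there, and
  \<open>Q x\<close> runs through the sets of points to be made finally dense.\<close>

locale construction = largeness Lg small + omega1_order lt
  for Lg :: "nat \<Rightarrow> (nat \<Rightarrow> bool) set \<Rightarrow> bool" and small :: "(nat \<Rightarrow> bool) set \<Rightarrow> bool"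
    and lt :: "real \<Rightarrow> real \<Rightarrow> bool" (infix "\<sqsubset>" 50) +
  fixes A :: "real \<Rightarrow> (nat \<times> (nat \<Rightarrow> bool)) set"
    and T :: "real \<Rightarrow> nat \<Rightarrow> (nat \<Rightarrow> bool) set"
    and b b' :: "real \<Rightarrow> real"
    and Q :: "real \<Rightarrow> real set"
  assumes large_A: "large (A a)"
    and small_T: "small (T g n)"
begin

text \<open>A stage \<^term>\<open>g\<close> contributes a triple \<^term>\<open>(z, e, v)\<close>: the trace \<^term>\<open>z\<close> of the new
  clopen set on the columns, the values at coordinate \<^term>\<open>g\<close> of the points with index
  at most \<^term>\<open>g\<close>, and the values of the point with index \<^term>\<open>g\<close> at earlier coordinates.\<close>

definition coord :: "(real \<Rightarrow> (nat \<times> (nat \<Rightarrow> bool)) set \<times> (real \<Rightarrow> bool) \<times> (real \<Rightarrow> bool)) \<Rightarrow>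
    real \<Rightarrow> (nat \<times> (nat \<Rightarrow> bool)) set" where
  "coord f g = fst (f g)"

definition val :: "(real \<Rightarrow> (nat \<times> (nat \<Rightarrow> bool)) set \<times> (real \<Rightarrow> bool) \<times> (real \<Rightarrow> bool)) \<Rightarrow>
    real \<Rightarrow> real \<Rightarrow> bool" where
  "val f a g = (if g \<sqsubset> a then snd (snd (f a)) g else fst (snd (f g)) a)"

definition cell where
  "cell f a s = {x \<in> A a. \<forall>g\<in>s. (x \<in> coord f g) = val f a g}"

text \<open>The prescribed values are given by a subset \<open>s'\<close> of \<open>s\<close>
  instead of a function, so that only countably many patterns occur before \<open>g\<close>. The
  bound \<open>upto g\<close> keeps later points out.\<close>

definition pattern where
  "pattern f g x s s' = {q \<in> Q x. q \<in> upto g \<and> (\<forall>d\<in>s. val f q d = (d \<in> s'))}"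

text \<open>Only indices in \<open>upto g\<close> are mentioned, so the condition depends on
  \<open>f\<close> strictly below \<open>g\<close>. The values at \<open>b g\<close> and
  \<open>b' g\<close> are imposed wherever these points lie; they become entries of the matrix when
  the points precede \<open>g\<close>.\<close>

definition stage where
  "stage f g r \<longleftrightarrow>
    (\<forall>n. clopen (fst r `` {n})) \<and>
    (\<forall>a s. a \<in> upto g \<and> finite s \<and> s \<subseteq> upto g \<longrightarrow> large (cell (f(g := r)) a s)) \<and>
    fst (snd r) (b g) \<and> (b g \<noteq> b' g \<longrightarrow> \<not> fst (snd r) (b' g)) \<and>
    (\<forall>n. fst r `` {n} \<inter> T g n = {}) \<and>
    (\<forall>x s s' c. x \<in> upto g \<and> finite s \<and> s \<subseteq> {d. d \<sqsubset> g} \<and> s' \<subseteq> s \<and>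
      infinite (pattern (f(g := r)) g x s s') \<longrightarrow>
      infinite {q \<in> pattern (f(g := r)) g x s s'. fst (snd r) q = c})"

text \<open>The locality that well-founded recursion by \<open>dependent_wf_choice\<close>
  requires.\<close>

lemma stage_cong:
  assumes "\<And>d. d \<sqsubset> g \<Longrightarrow> f d = f' d"
  shows "stage f g r = stage f' g r"
proof -
  have eq: "(f(g := r)) d = (f'(g := r)) d" if "d \<in> upto g" for d
    using assms that by (auto simp: upto_def)
  have val: "val (f(g := r)) a d = val (f'(g := r)) a d" if "a \<in> upto g" "d \<in> upto g" for a d
    unfolding val_def by (simp only: eq[OF that(1)] eq[OF that(2)])
  have cell: "cell (f(g := r)) a s = cell (f'(g := r)) a s" if "a \<in> upto g" "s \<subseteq> upto g" for a s
  proof -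
    have "coord (f(g := r)) d = coord (f'(g := r)) d" "val (f(g := r)) a d = val (f'(g := r)) a d"
      if "d \<in> s" for d
      using that \<open>a \<in> upto g\<close> \<open>s \<subseteq> upto g\<close> eq val unfolding coord_def by (metis subsetD)+
    then show ?thesis unfolding cell_def by blast
  qed
  have pat: "pattern (f(g := r)) g x s s' = pattern (f'(g := r)) g x s s'" if "s \<subseteq> {d. d \<sqsubset> g}" for x s s'
  proof -
    have "val (f(g := r)) q d = val (f'(g := r)) q d" if "d \<in> s" "q \<in> upto g" for d q
      using that \<open>s \<subseteq> _\<close> by (intro val) (auto simp: upto_def)
    then show ?thesis unfolding pattern_def by blast
  qed
  have 1: "(\<forall>a s. a \<in> upto g \<and> finite s \<and> s \<subseteq> upto g \<longrightarrow> large (cell (f(g := r)) a s)) =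
      (\<forall>a s. a \<in> upto g \<and> finite s \<and> s \<subseteq> upto g \<longrightarrow> large (cell (f'(g := r)) a s))"
    using cell by metis
  have 2: "(\<forall>x s s' c. x \<in> upto g \<and> finite s \<and> s \<subseteq> {d. d \<sqsubset> g} \<and> s' \<subseteq> s \<and>
        infinite (pattern (f(g := r)) g x s s') \<longrightarrow>
        infinite {q \<in> pattern (f(g := r)) g x s s'. fst (snd r) q = c}) =
      (\<forall>x s s' c. x \<in> upto g \<and> finite s \<and> s \<subseteq> {d. d \<sqsubset> g} \<and> s' \<subseteq> s \<and>
        infinite (pattern (f'(g := r)) g x s s') \<longrightarrow>
        infinite {q \<in> pattern (f'(g := r)) g x s s'. fst (snd r) q = c})"
  proof (rule iff_allI)+
    fix x s s' c
    show "(x \<in> upto g \<and> finite s \<and> s \<subseteq> {d. d \<sqsubset> g} \<and> s' \<subseteq> s \<and>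
        infinite (pattern (f(g := r)) g x s s') \<longrightarrow>
        infinite {q \<in> pattern (f(g := r)) g x s s'. fst (snd r) q = c}) =
      (x \<in> upto g \<and> finite s \<and> s \<subseteq> {d. d \<sqsubset> g} \<and> s' \<subseteq> s \<and>
        infinite (pattern (f'(g := r)) g x s s') \<longrightarrow>
        infinite {q \<in> pattern (f'(g := r)) g x s s'. fst (snd r) q = c})"
    proof (cases "s \<subseteq> {d. d \<sqsubset> g}")
      case True
      show ?thesis by (simp only: pat[OF True])
    qed blast
  qed
  show ?thesis unfolding stage_def by (simp only: 1 2)
qed

text \<open>The three components are independent enough to be chosen in turn. The values
  \<open>v\<close> keep the promise of the new point at the old coordinates. Then \<open>e\<close>
  is chosen only to split patterns and to separate, because \<open>fusion\<close> can keep every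
  promise on whichever side \<open>e\<close> assigns to it; this yields \<open>z\<close>.\<close>

lemma stage_exists:
  assumes prev: "\<And>d. d \<sqsubset> g \<Longrightarrow> stage f d (f d)"
  shows "\<exists>r. stage f g r"
proof -
  have "\<exists>v. \<forall>s. finite s \<and> s \<subseteq> {d. d \<sqsubset> g} \<longrightarrow>
      large {x \<in> A g. \<forall>d\<in>s. (x \<in> coord f d) = v d}"
    by (rule coherent_choice[OF countable_lt large_A large_split])
      (simp_all add: large_mono large_empty)
  then obtain v where v: "\<And>s. finite s \<Longrightarrow> s \<subseteq> {d. d \<sqsubset> g} \<Longrightarrow>
      large {x \<in> A g. \<forall>d\<in>s. (x \<in> coord f d) = v d}" by blast
  define h where "h r = f(g := r)" for r
  \<comment> \<open>The trace and the values in \<open>h0\<close> are placeholders: cells and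
    patterns over coordinates before \<open>g\<close> see only \<open>v\<close> and the earlier
    stages.\<close>
  define h0 where "h0 = h ({}, \<lambda>_. False, v)"
  have val0: "val (h (z, e, v)) a d = val h0 a d" if "d \<sqsubset> g" for z e a d
    using that by (auto simp: val_def h0_def h_def)
  have coord0: "coord (h (z, e, v)) d = coord h0 d" if "d \<sqsubset> g" for z e d
    using that by (auto simp: coord_def h0_def h_def)
  have cell0: "cell (h (z, e, v)) a s = cell h0 a s" if "s \<subseteq> {d. d \<sqsubset> g}" for z e a s
    using that val0 coord0 unfolding cell_def by blast
  have pat0: "pattern (h (z, e, v)) g x s s' = pattern h0 g x s s'" if "s \<subseteq> {d. d \<sqsubset> g}" for z e x s s'
    using that val0 unfolding pattern_def by blast
  have large0: "large (cell h0 a s)" if "a \<in> upto g" "finite s" "s \<subseteq> {d. d \<sqsubset> g}" for a s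
  proof (cases "a = g")
    case True
    have "coord h0 d = coord f d" "val h0 g d = v d" if "d \<in> s" for d
      using that \<open>s \<subseteq> _\<close> by (auto simp: h0_def h_def coord_def val_def)
    then have "cell h0 a s = {x \<in> A g. \<forall>d\<in>s. (x \<in> coord f d) = v d}"
      unfolding cell_def True by blast
    then show ?thesis using v that by simp
  next
    case False
    then have a: "a \<sqsubset> g" using that(1) by (simp add: upto_def)
    \<comment> \<open>The promise for an old point and old coordinates was already secured at the
      latest index involved, which still precedes \<open>g\<close>.\<close>
    obtain m where m: "m \<in> insert a s" "insert a s \<subseteq> upto m"
      using finite_has_max[of "insert a s"] \<open>finite s\<close> by blast
    have "m \<sqsubset> g" using m(1) a that(3) by auto
    then have "large (cell f a s)"
      using prev[of m] m(2) that(2) unfolding stage_def by simp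
    moreover have "cell f a s = cell h0 a s"
    proof -
      have "coord f d = coord h0 d" "val f a d = val h0 a d" if "d \<in> s" for d
        using that \<open>s \<subseteq> _\<close> a by (auto simp: coord_def val_def h0_def h_def)
      then show ?thesis unfolding cell_def by blast
    qed
    ultimately show ?thesis by simp
  qed
  define F where "F = {K. infinite K \<and> (\<exists>x\<in>upto g. \<exists>s\<in>{s. s \<subseteq> {d. d \<sqsubset> g} \<and> finite s}.
    \<exists>s'\<in>{s. s \<subseteq> {d. d \<sqsubset> g} \<and> finite s}. K = pattern h0 g x s s')}"
  have fin: "countable {s. s \<subseteq> {d. d \<sqsubset> g} \<and> finite s}"
    using countable_Collect_finite_subset[OF countable_lt] by (simp add: conj_commute)
  have "countable F"
    by (rule countable_subset[where B = "(\<lambda>(x, s, s'). pattern h0 g x s s') `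
        (upto g \<times> {s. s \<subseteq> {d. d \<sqsubset> g} \<and> finite s} \<times> {s. s \<subseteq> {d. d \<sqsubset> g} \<and> finite s})"])
      (auto simp: F_def image_iff intro!: countable_image countable_SIGMA fin countable_upto)
  moreover have "infinite K" if "K \<in> F" for K using that by (simp add: F_def)
  ultimately obtain e where e: "e (b g)" "b g \<noteq> b' g \<Longrightarrow> \<not> e (b' g)"
    "\<And>K c. K \<in> F \<Longrightarrow> infinite {q \<in> K. e q = c}"
    using splitting_predicate[of F "b g" "b' g"] by blast
  \<comment> \<open>Pairs of a point and a finite set of old coordinates; keeping each of these
    cells large on the side \<open>e\<close> is the promise with \<open>g\<close> added.\<close>
  define J where "J = upto g \<times> {s. s \<subseteq> {d. d \<sqsubset> g} \<and> finite s}"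
  have "countable J" unfolding J_def by (intro countable_SIGMA countable_upto fin)
  moreover have "large (cell h0 (fst k) (snd k))" if "k \<in> J" for k
    using that large0 by (auto simp: J_def)
  ultimately obtain z where z: "\<And>n. clopen (z `` {n})" "\<And>n. z `` {n} \<inter> T g n = {}"
    "\<And>k. k \<in> J \<Longrightarrow> large {x \<in> cell h0 (fst k) (snd k). (x \<in> z) = e (fst k)}"
    using fusion[of J "\<lambda>k. cell h0 (fst k) (snd k)" "T g" "\<lambda>k. e (fst k)"] small_T by blast
  have "stage f g (z, e, v)"
    unfolding stage_def fst_conv snd_conv h_def[symmetric]
  proof (intro conjI allI impI)
    show "clopen (z `` {n})" for n by (rule z)
    show "z `` {n} \<inter> T g n = {}" for n by (rule z)
    show "e (b g)" by (rule e)
    show "\<not> e (b' g)" if "b g \<noteq> b' g" using that by (rule e)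
  next
    fix a s assume "a \<in> upto g \<and> finite s \<and> s \<subseteq> upto g"
    then have a: "a \<in> upto g" and s: "finite s" "s \<subseteq> upto g" by auto
    have s0: "s - {g} \<subseteq> {d. d \<sqsubset> g}" using s(2) by (auto simp: upto_def)
    have "large {x \<in> cell h0 a (s - {g}). (x \<in> z) = e a}"
      using z(3)[of "(a, s - {g})"] a s s0 by (simp add: J_def)
    moreover have "{x \<in> cell h0 a (s - {g}). (x \<in> z) = e a} \<subseteq> cell (h (z, e, v)) a s"
    proof -
      have "coord (h (z, e, v)) g = z" by (simp add: coord_def h_def)
      moreover have "val (h (z, e, v)) a g = e a" using a by (simp add: val_def h_def upto_iff)
      ultimately have "{x \<in> cell (h (z, e, v)) a (s - {g}). (x \<in> z) = e a} \<subseteq> cell (h (z, e, v)) a s"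
        unfolding cell_def by auto
      then show ?thesis by (simp only: cell0[OF s0])
    qed
    ultimately show "large (cell (h (z, e, v)) a s)" by (rule large_mono)
  next
    fix x s s' c
    assume *: "x \<in> upto g \<and> finite s \<and> s \<subseteq> {d. d \<sqsubset> g} \<and> s' \<subseteq> s \<and>
      infinite (pattern (h (z, e, v)) g x s s')"
    then have eq: "pattern (h (z, e, v)) g x s s' = pattern h0 g x s s'" by (intro pat0) simp
    have "s' \<subseteq> {d. d \<sqsubset> g}" "finite s'" using * by (auto intro: finite_subset)
    then have "pattern h0 g x s s' \<in> F" unfolding F_def using * eq by auto
    then show "infinite {q \<in> pattern (h (z, e, v)) g x s s'. e q = c}"
      unfolding eq by (rule e)
  qed
  then show ?thesis ..
qed

text \<open>Finite sets of indices lie below one of their members, so the promises made stage by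
  stage combine into global ones. Only the last clause needs a further induction.\<close>

proposition matrix_exists:
  "\<exists>Z p. (\<forall>g n. clopen (Z g `` {n})) \<and>
    (\<forall>a s. finite s \<longrightarrow> large {x \<in> A a. \<forall>g\<in>s. (x \<in> Z g) = p a g}) \<and>
    (\<forall>g. b g \<sqsubset> g \<longrightarrow> p (b g) g) \<and>
    (\<forall>g. b' g \<sqsubset> g \<and> b g \<noteq> b' g \<longrightarrow> \<not> p (b' g) g) \<and>
    (\<forall>g n. Z g `` {n} \<inter> T g n = {}) \<and>
    (\<forall>x. countable (Q x) \<and> infinite (Q x) \<longrightarrow>
      (\<exists>g. \<forall>t f. finite t \<and> t \<inter> upto g = {} \<longrightarrow> infinite {q \<in> Q x. \<forall>d\<in>t. p q d = f d}))"
proof -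
  have "\<exists>f. \<forall>g. stage f g (f g)"
  proof (rule dependent_wf_choice[OF wf_lt])
    show "stage f g r = stage f' g r" if "\<And>d. (d, g) \<in> {(x, y). x \<sqsubset> y} \<Longrightarrow> f d = f' d" for f f' g r
      using that by (intro stage_cong) simp
    show "\<exists>r. stage f g r" if "\<And>d. (d, g) \<in> {(x, y). x \<sqsubset> y} \<Longrightarrow> stage f d (f d)" for f g
      using that by (intro stage_exists) simp
  qed
  then obtain f where f: "\<And>g. stage f g (f g)" by blast
  have p: "val f a g = fst (snd (f g)) a" if "a \<sqsubset> g" for a g
    using that lt_asym by (auto simp: val_def)
  show ?thesis
  proof (intro exI[of _ "coord f"] exI[of _ "val f"] conjI allI impI)
    show "clopen (coord f g `` {n})" for g n
      using f[of g] by (simp add: stage_def coord_def)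
    show "large {x \<in> A a. \<forall>g\<in>s. (x \<in> coord f g) = val f a g}" if "finite s" for a s
    proof -
      obtain m where "insert a s \<subseteq> upto m" using finite_has_max[of "insert a s"] \<open>finite s\<close> by auto
      then have "large (cell f a s)" using f[of m] that by (simp add: stage_def)
      then show ?thesis by (simp add: cell_def)
    qed
    show "val f (b g) g" if "b g \<sqsubset> g" for g
      using f[of g] by (simp add: stage_def p[OF that])
    show "\<not> val f (b' g) g" if "b' g \<sqsubset> g \<and> b g \<noteq> b' g" for g
      using f[of g] that by (simp add: stage_def p)
    show "coord f g `` {n} \<inter> T g n = {}" for g n
      using f[of g] by (simp add: stage_def coord_def)
    fix x assume Q: "countable (Q x) \<and> infinite (Q x)"
    \<comment> \<open>The index \<open>x\<close> has to be bounded too: a stage splits the patterns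
      of \<open>Q x\<close> only once \<open>x\<close> has appeared.\<close>
    then obtain g0 where g0: "\<And>q. q \<in> insert x (Q x) \<Longrightarrow> q \<sqsubset> g0"
      using countable_bounded[of "insert x (Q x)" UNIV] uncountable_UNIV_real by auto
    \<comment> \<open>The largest coordinate \<open>m\<close> of \<open>t\<close> is removed. The
      remaining coordinates define an infinite pattern by induction, and stage \<open>m\<close> made
      both of its halves infinite.\<close>
    have "infinite {q \<in> Q x. \<forall>d\<in>t. val f q d = y d}" if "finite t" "t \<inter> upto g0 = {}" for t y
      using that
    proof (induction "card t" arbitrary: t)
      case 0
      then show ?case using Q by simp
    next
      case (Suc n)
      then obtain m where m: "m \<in> t" "t \<subseteq> upto m"
        using finite_has_max[of t] by (metis card.empty nat.distinct(1))
      define s where "s = t - {m}"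
      define s' where "s' = {d \<in> s. y d}"
      have s: "finite s" "s \<subseteq> {d. d \<sqsubset> m}" "s' \<subseteq> s" "s \<inter> upto g0 = {}" "card s = n"
        using m Suc.prems Suc.hyps(2) by (auto simp: s_def s'_def upto_def)
      have "g0 \<sqsubset> m" using m(1) Suc.prems(2) by (auto simp: upto_iff)
      then have lt: "q \<sqsubset> m" if "q \<in> insert x (Q x)" for q using g0[OF that] lt_trans by blast
      have "pattern f m x s s' = {q \<in> Q x. \<forall>d\<in>s. val f q d = y d}"
        using lt by (auto simp: pattern_def upto_def s'_def)
      then have "infinite (pattern f m x s s')"
        using Suc.hyps(1)[of s] s by simp
      then have "infinite {q \<in> pattern f m x s s'. fst (snd (f m)) q = y m}"
        using f[of m] s lt[of x] by (simp add: stage_def upto_def)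
      moreover have "{q \<in> pattern f m x s s'. fst (snd (f m)) q = y m} \<subseteq> {q \<in> Q x. \<forall>d\<in>t. val f q d = y d}"
        using p lt by (auto simp: pattern_def s_def s'_def)
      ultimately show ?case by (meson finite_subset)
    qed
    then show "\<exists>g. \<forall>t y. finite t \<and> t \<inter> upto g = {} \<longrightarrow> infinite {q \<in> Q x. \<forall>d\<in>t. val f q d = y d}"
      by (intro exI[of _ g0]) blast
  qed
qed

end

section \<open>The space attached to a matrix\<close>

text \<open>The two negative elements encode the column and keep \<open>col n t\<close> apart from the
  singletons \<open>pt a\<close>.\<close>

definition col :: "nat \<Rightarrow> (nat \<Rightarrow> bool) \<Rightarrow> real set" where
  "col n t = insert (-1) (insert (- 2 - real n) (real ` {i. t i}))"

definition pt :: "real \<Rightarrow> real set" where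
  "pt a = {a}"

lemma pt_eq_iff [simp]: "pt a = pt c \<longleftrightarrow> a = c"
  by (simp add: pt_def)

lemma col_eq_iff [simp]: "col n t = col m u \<longleftrightarrow> n = m \<and> t = u"
proof
  assume eq: "col n t = col m u"
  have mem: "real i \<in> col k w \<longleftrightarrow> w i" "- 2 - real i \<in> col k w \<longleftrightarrow> i = k" for i k w
    by (auto simp: col_def)
  have "n = m" using mem(2)[of n n t] mem(2)[of n m u] eq by simp
  moreover have "t i = u i" for i using mem(1)[of i n t] mem(1)[of i m u] eq by simp
  ultimately show "n = m \<and> t = u" by auto
qed auto

lemma col_neq_pt [simp]: "col n t \<noteq> pt a" "pt a \<noteq> col n t"
proof -
  have "-1 \<in> col n t" "- 2 - real n \<in> col n t" "-1 \<noteq> - 2 - real n" by (auto simp: col_def)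
  then show "col n t \<noteq> pt a" "pt a \<noteq> col n t" unfolding pt_def by (metis singletonD)+
qed

text \<open>A countable dense subset of each column. Selections inside it have codes among the
  reals.\<close>

definition finite_support :: "(nat \<Rightarrow> bool) set" where
  "finite_support = {t. finite {i. t i}}"

text \<open>Takes the place of a countable elementary submodel in the proof of countable
  tightness.\<close>

lemma closing_off:
  fixes h :: "'a set \<Rightarrow> 'a set"
  assumes "\<And>s. countable (h s)"
  obtains H where "countable H" "\<And>s. finite s \<Longrightarrow> s \<subseteq> H \<Longrightarrow> h s \<subseteq> H"
proof -
  define F where "F = rec_nat {} (\<lambda>_ K. K \<union> (\<Union>s\<in>{s. s \<subseteq> K \<and> finite s}. h s))"
  have FS: "F (Suc n) = F n \<union> (\<Union>s\<in>{s. s \<subseteq> F n \<and> finite s}. h s)" and F0: "F 0 = {}" for n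
    by (simp_all add: F_def)
  have "countable (F n)" for n
  proof (induction n)
    case (Suc n)
    then have "countable {s. s \<subseteq> F n \<and> finite s}"
      using countable_Collect_finite_subset[of "F n"] by (simp add: conj_commute)
    then show ?case using Suc assms by (simp add: FS)
  qed (simp add: F0)
  then have "countable (\<Union>n. F n)" by simp
  moreover have "h s \<subseteq> (\<Union>n. F n)" if s: "finite s" "s \<subseteq> (\<Union>n. F n)" for s
  proof -
    have mono: "F m \<subseteq> F n" if "m \<le> n" for m n
      using that by (induction rule: dec_induct) (auto simp: FS)
    have "\<exists>n. s \<subseteq> F n" using s
    proof (induction s)
      case (insert x s)
      from insert.prems obtain m where "x \<in> F m" by blast
      moreover obtain n where "s \<subseteq> F n" using insert.IH insert.prems by blast
      ultimately have "insert x s \<subseteq> F (max m n)" using mono[of m "max m n"] mono[of n "max m n"] by auto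
      then show ?case ..
    qed simp
    then obtain n where "s \<subseteq> F n" ..
    then have "h s \<subseteq> F (Suc n)" using s(1) by (auto simp: FS)
    then show ?thesis by blast
  qed
  ultimately show thesis using that by blast
qed

text \<open>Everything the topology uses; the well-order is gone. In \<open>p_finally_dense\<close>
  the countable set \<open>H\<close> stands for an initial segment, and \<open>p_realizes\<close>
  turns every large selection of finitely supported points into one with an accumulation
  point.\<close>

locale matrix_space = largeness Lg small
  for Lg :: "nat \<Rightarrow> (nat \<Rightarrow> bool) set \<Rightarrow> bool" and small :: "(nat \<Rightarrow> bool) set \<Rightarrow> bool" +
  fixes Z :: "real \<Rightarrow> (nat \<times> (nat \<Rightarrow> bool)) set" and p :: "real \<Rightarrow> real \<Rightarrow> bool"
  assumes clopen_Z: "clopen (Z g `` {n})"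
    and p_dense: "finite s \<Longrightarrow> large {x. \<forall>g\<in>s. (x \<in> Z g) = p a g}"
    and p_separating: "a \<noteq> c \<Longrightarrow> \<exists>g. p a g \<noteq> p c g"
    and p_finally_dense: "countable K \<Longrightarrow> infinite K \<Longrightarrow>
      \<exists>H. countable H \<and> (\<forall>t f. finite t \<and> t \<inter> H = {} \<longrightarrow> (\<exists>q\<in>K. \<forall>d\<in>t. p q d = f d))"
    and p_realizes: "large A \<Longrightarrow> A \<subseteq> UNIV \<times> finite_support \<Longrightarrow>
      \<exists>a. \<forall>s. finite s \<longrightarrow> large {x \<in> A. \<forall>g\<in>s. (x \<in> Z g) = p a g}"
    and p_avoids: "(\<And>n. small (T n)) \<Longrightarrow> (\<And>n. cantor_closed (T n)) \<Longrightarrow>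
      \<exists>g. p a g \<and> (\<forall>n. Z g `` {n} \<inter> T n = {})"
begin

section \<open>Basic clopen sets, separation and dimension\<close>

definition cyl :: "nat \<Rightarrow> (nat \<Rightarrow> bool) \<Rightarrow> nat \<Rightarrow> real set set" where
  "cyl n t k = col n ` {u. agree k t u}"

text \<open>The bound \<open>m\<close> discards finitely many columns, so that every column is
  closed.\<close>

definition nb :: "real \<Rightarrow> real set \<Rightarrow> nat \<Rightarrow> real set set" where
  "nb a s m = pt ` {c. \<forall>g\<in>s. p c g = p a g} \<union>
    {col n u | n u. m \<le> n \<and> (\<forall>g\<in>s. ((n, u) \<in> Z g) = p a g)}"

definition points :: "real set set" where
  "points = range pt \<union> {col n u | n u. True}"

definition X :: "real set topology" where
  "X = topology (\<lambda>W. W \<subseteq> points \<and>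
    (\<forall>n t. col n t \<in> W \<longrightarrow> (\<exists>k. cyl n t k \<subseteq> W)) \<and>
    (\<forall>a. pt a \<in> W \<longrightarrow> (\<exists>s m. finite s \<and> nb a s m \<subseteq> W)))"

lemma points_cases:
  assumes "x \<in> points"
  obtains (pt) a where "x = pt a" | (col) n u where "x = col n u"
  using assms by (auto simp: points_def)

lemma col_in_points [simp]: "col n u \<in> points" and pt_in_points [simp]: "pt a \<in> points"
  by (auto simp: points_def)

lemma col_in_cyl [simp]: "col m u \<in> cyl n t k \<longleftrightarrow> m = n \<and> agree k t u"
  by (auto simp: cyl_def)

lemma pt_in_cyl [simp]: "pt a \<notin> cyl n t k"
  by (auto simp: cyl_def)

lemma col_in_nb [simp]: "col n u \<in> nb a s m \<longleftrightarrow> m \<le> n \<and> (\<forall>g\<in>s. ((n, u) \<in> Z g) = p a g)"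
  by (auto simp: nb_def)

lemma pt_in_nb [simp]: "pt c \<in> nb a s m \<longleftrightarrow> (\<forall>g\<in>s. p c g = p a g)"
  by (auto simp: nb_def)

lemma cyl_subset_points: "cyl n t k \<subseteq> points" and nb_subset_points: "nb a s m \<subseteq> points"
  by (auto simp: cyl_def nb_def points_def)

lemma points_subsetI:
  assumes "V \<subseteq> points" "\<And>n u. col n u \<in> V \<Longrightarrow> col n u \<in> W" "\<And>a. pt a \<in> V \<Longrightarrow> pt a \<in> W"
  shows "V \<subseteq> W"
  using assms by (metis points_cases subsetD subsetI)

lemma nb_mono: "s \<subseteq> s' \<Longrightarrow> m \<le> m' \<Longrightarrow> nb a s' m' \<subseteq> nb a s m"
  by (rule points_subsetI[OF nb_subset_points]) auto

lemma cyl_mono: "k \<le> k' \<Longrightarrow> cyl n t k' \<subseteq> cyl n t k"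
  by (rule points_subsetI[OF cyl_subset_points]) (auto intro: agree_mono)

lemma openin_X:
  "openin X W \<longleftrightarrow> W \<subseteq> points \<and>
    (\<forall>n t. col n t \<in> W \<longrightarrow> (\<exists>k. cyl n t k \<subseteq> W)) \<and>
    (\<forall>a. pt a \<in> W \<longrightarrow> (\<exists>s m. finite s \<and> nb a s m \<subseteq> W))"
proof -
  have "istopology (\<lambda>W. W \<subseteq> points \<and>
    (\<forall>n t. col n t \<in> W \<longrightarrow> (\<exists>k. cyl n t k \<subseteq> W)) \<and>
    (\<forall>a. pt a \<in> W \<longrightarrow> (\<exists>s m. finite s \<and> nb a s m \<subseteq> W)))" (is "istopology ?P")
    unfolding istopology_def
  proof (intro conjI allI impI)
    fix S V assume S: "?P S" and V: "?P V"
    show "S \<inter> V \<subseteq> points" using S by blast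
    show "\<exists>k. cyl n t k \<subseteq> S \<inter> V" if ST: "col n t \<in> S \<inter> V" for n t
    proof -
      obtain k where k: "cyl n t k \<subseteq> S" using S ST by blast
      obtain k' where k': "cyl n t k' \<subseteq> V" using V ST by blast
      have "cyl n t (max k k') \<subseteq> S \<inter> V"
        using k k' cyl_mono[of k "max k k'" n t] cyl_mono[of k' "max k k'" n t] by auto
      then show ?thesis ..
    qed
    show "\<exists>s m. finite s \<and> nb a s m \<subseteq> S \<inter> V" if ST: "pt a \<in> S \<inter> V" for a
    proof -
      obtain s m where s: "finite s" "nb a s m \<subseteq> S" using S ST by blast
      obtain s' m' where s': "finite s'" "nb a s' m' \<subseteq> V" using V ST by blast
      have "nb a (s \<union> s') (max m m') \<subseteq> S \<inter> V"
        using s s' nb_mono[of s "s \<union> s'" m "max m m'" a] nb_mono[of s' "s \<union> s'" m' "max m m'" a]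
        by auto
      then show ?thesis using s(1) s'(1) by (meson finite_UnI)
    qed
  next
    fix K assume K: "\<forall>S\<in>K. ?P S"
    have "S \<subseteq> points" if "S \<in> K" for S using K that by simp
    then show "\<Union> K \<subseteq> points" by (rule Union_least)
    show "\<exists>k. cyl n t k \<subseteq> \<Union> K" if t: "col n t \<in> \<Union> K" for n t
    proof -
      obtain S where S: "S \<in> K" "col n t \<in> S" using t by blast
      then obtain k where "cyl n t k \<subseteq> S" using K by meson
      then show ?thesis using S(1) by (meson Union_upper order_trans)
    qed
    show "\<exists>s m. finite s \<and> nb a s m \<subseteq> \<Union> K" if a: "pt a \<in> \<Union> K" for a
    proof -
      obtain S where S: "S \<in> K" "pt a \<in> S" using a by blast
      then obtain s m where "finite s" "nb a s m \<subseteq> S" using K by meson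
      then show ?thesis using S(1) by (meson Union_upper order_trans)
    qed
  qed
  then show ?thesis unfolding X_def by (simp add: topology_inverse')
qed

lemma topspace_X [simp]: "topspace X = points"
proof -
  have "openin X points"
    by (auto simp: openin_X cyl_subset_points nb_subset_points)
  then have "points \<subseteq> topspace X" by (rule openin_subset)
  moreover have "topspace X \<subseteq> points" using openin_topspace[of X] unfolding openin_X by (rule conjunct1)
  ultimately show ?thesis by simp
qed

text \<open>Clopen sections of the \<open>Z g\<close> make each short enough cylinder lie on one
  side of all of them; hence the sets \<open>nb a s m\<close> are clopen.\<close>

lemma uniform_level:
  assumes "finite s"
  shows "\<exists>k. \<forall>u w. agree k u w \<longrightarrow> (\<forall>g\<in>s. ((n, u) \<in> Z g) = ((n, w) \<in> Z g))"
  using assms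
proof (induction s)
  case (insert g s)
  then obtain k where k: "\<And>u w. agree k u w \<Longrightarrow> (\<forall>g\<in>s. ((n, u) \<in> Z g) = ((n, w) \<in> Z g))" by blast
  obtain j where j: "\<And>u w. agree j u w \<Longrightarrow> ((n, u) \<in> Z g) = ((n, w) \<in> Z g)"
    using clopen_Z[of g n] unfolding clopen_def Image_singleton_iff by blast
  have "\<forall>h\<in>insert g s. ((n, u) \<in> Z h) = ((n, w) \<in> Z h)" if "agree (max j k) u w" for u w
    using j[of u w] k[of u w] agree_mono[OF that, of j] agree_mono[OF that, of k] by simp
  then show ?case by blast
qed simp

lemma openin_cyl: "openin X (cyl n t k)"
  unfolding openin_X
proof (intro conjI allI impI)
  show "\<exists>j. cyl m u j \<subseteq> cyl n t k" if "col m u \<in> cyl n t k" for m u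
    using that by (intro exI[of _ k] points_subsetI[OF cyl_subset_points]) (auto intro: agree_trans)
qed (simp_all add: cyl_subset_points)

lemma closedin_cyl: "closedin X (cyl n t k)"
  unfolding closedin_def openin_X topspace_X
proof (intro conjI allI impI)
  show "\<exists>j. cyl m u j \<subseteq> points - cyl n t k" if "col m u \<in> points - cyl n t k" for m u
    using that
    by (intro exI[of _ k] points_subsetI[OF cyl_subset_points]) (auto intro: agree_trans agree_sym)
  show "\<exists>s m. finite s \<and> nb a s m \<subseteq> points - cyl n t k" for a
    by (intro exI[of _ "{}"] exI[of _ "Suc n"] conjI points_subsetI[OF nb_subset_points]) auto
qed (auto simp: cyl_subset_points)

lemma openin_nb:
  assumes "finite s"
  shows "openin X (nb a s m)"
  unfolding openin_X
proof (intro conjI allI impI)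
  show "\<exists>j. cyl n u j \<subseteq> nb a s m" if "col n u \<in> nb a s m" for n u
  proof -
    obtain k where k: "\<And>w. agree k u w \<Longrightarrow> \<forall>g\<in>s. ((n, u) \<in> Z g) = ((n, w) \<in> Z g)"
      using uniform_level[OF assms, of n] by blast
    show ?thesis
      using that k by (intro exI[of _ k] points_subsetI[OF cyl_subset_points]) auto
  qed
  show "\<exists>s' m'. finite s' \<and> nb c s' m' \<subseteq> nb a s m" if "pt c \<in> nb a s m" for c
    using that assms by (intro exI[of _ s] exI[of _ m] conjI points_subsetI[OF nb_subset_points]) auto
qed (simp add: nb_subset_points)

lemma closedin_nb:
  assumes "finite s"
  shows "closedin X (nb a s m)"
  unfolding closedin_def openin_X topspace_X
proof (intro conjI allI impI)
  show "\<exists>j. cyl n u j \<subseteq> points - nb a s m" if "col n u \<in> points - nb a s m" for n u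
  proof -
    obtain k where k: "\<And>w. agree k u w \<Longrightarrow> \<forall>g\<in>s. ((n, u) \<in> Z g) = ((n, w) \<in> Z g)"
      using uniform_level[OF assms, of n] by blast
    show ?thesis
      using that k by (intro exI[of _ k] points_subsetI[OF cyl_subset_points]) auto
  qed
  show "\<exists>s' m'. finite s' \<and> nb c s' m' \<subseteq> points - nb a s m" if "pt c \<in> points - nb a s m" for c
    using that assms by (intro exI[of _ s] exI[of _ m] conjI points_subsetI[OF nb_subset_points]) auto
qed (auto simp: nb_subset_points)

lemma Hausdorff_X: "Hausdorff_space X"
  unfolding Hausdorff_space_def
proof (intro allI impI)
  have sep: "\<exists>U V. openin X U \<and> openin X V \<and> x \<in> U \<and> y \<in> V \<and> disjnt U V"
    if "y \<in> points" "y \<notin> W" "x \<in> W" "openin X W" "closedin X W" for x y W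
  proof -
    have "openin X (points - W)" using that(5) by (simp add: closedin_def)
    moreover have "disjnt W (points - W)" "y \<in> points - W" using that by (auto simp: disjnt_def)
    ultimately show ?thesis using that by blast
  qed
  fix x y assume "x \<in> topspace X \<and> y \<in> topspace X \<and> x \<noteq> y"
  then have x: "x \<in> points" and y: "y \<in> points" and "x \<noteq> y" by auto
  from x show "\<exists>U V. openin X U \<and> openin X V \<and> x \<in> U \<and> y \<in> V \<and> disjnt U V"
  proof (cases rule: points_cases)
    case (col n t)
    have "\<exists>k. y \<notin> cyl n t k"
      using y
    proof (cases rule: points_cases)
      case c: (col m u)
      then show ?thesis using \<open>x \<noteq> y\<close> agree_all_imp_eq[of t u] by (auto simp: \<open>x = col n t\<close>)
    qed simp
    then show ?thesis using sep[OF y _ _ openin_cyl closedin_cyl] \<open>x = col n t\<close> by fastforce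
  next
    case (pt a)
    have "\<exists>s m. finite s \<and> y \<notin> nb a s m"
      using y
    proof (cases rule: points_cases)
      case c: (pt c)
      then obtain g where "p a g \<noteq> p c g"
        using p_separating[of a c] \<open>x \<noteq> y\<close> \<open>x = pt a\<close> by auto
      then show ?thesis using c by (intro exI[of _ "{g}"] exI[of _ 0]) auto
    next
      case c: (col m u)
      then show ?thesis by (intro exI[of _ "{}"] exI[of _ "Suc m"]) auto
    qed
    then show ?thesis using sep[OF y _ _ openin_nb closedin_nb] \<open>x = pt a\<close> by fastforce
  qed
qed

lemma zero_dim_X: "X dim_le 0"
  unfolding dimension_le_0_neighbourhood_base_of_clopen neighbourhood_base_of
proof (intro allI impI)
  fix W x assume W: "openin X W \<and> x \<in> W"
  then have "x \<in> points" by (auto simp: openin_X)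
  then have "\<exists>U. openin X U \<and> closedin X U \<and> x \<in> U \<and> U \<subseteq> W"
  proof (cases rule: points_cases)
    case (pt a)
    then obtain s m where "finite s" "nb a s m \<subseteq> W" using W unfolding openin_X by blast
    then show ?thesis using openin_nb closedin_nb pt by (intro exI[of _ "nb a s m"]) auto
  next
    case (col n t)
    then obtain k where "cyl n t k \<subseteq> W" using W unfolding openin_X by blast
    then show ?thesis using openin_cyl closedin_cyl col by (intro exI[of _ "cyl n t k"]) auto
  qed
  then show "\<exists>U V. openin X U \<and> (closedin X V \<and> openin X V) \<and> x \<in> U \<and> U \<subseteq> V \<and> V \<subseteq> W"
    by blast
qed

lemma in_closure_col: "col n t \<in> X closure_of A \<longleftrightarrow> (\<forall>k. \<exists>u. agree k t u \<and> col n u \<in> A)"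
proof
  assume A: "col n t \<in> X closure_of A"
  show "\<forall>k. \<exists>u. agree k t u \<and> col n u \<in> A"
  proof
    fix k
    have "\<exists>y. y \<in> A \<and> y \<in> cyl n t k"
      using A openin_cyl[of n t k] by (auto simp: in_closure_of)
    then show "\<exists>u. agree k t u \<and> col n u \<in> A" by (auto simp: cyl_def)
  qed
next
  assume A: "\<forall>k. \<exists>u. agree k t u \<and> col n u \<in> A"
  show "col n t \<in> X closure_of A"
    unfolding in_closure_of
  proof (intro conjI allI impI)
    fix W assume "col n t \<in> W \<and> openin X W"
    then obtain k where "cyl n t k \<subseteq> W" unfolding openin_X by blast
    moreover obtain u where "agree k t u" "col n u \<in> A" using A by blast
    ultimately show "\<exists>y. y \<in> A \<and> y \<in> W" by (meson col_in_cyl subsetD)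
  qed simp
qed

lemma in_closure_pt: "pt a \<in> X closure_of A \<longleftrightarrow> (\<forall>s m. finite s \<longrightarrow> nb a s m \<inter> A \<noteq> {})"
proof
  assume A: "pt a \<in> X closure_of A"
  show "\<forall>s m. finite s \<longrightarrow> nb a s m \<inter> A \<noteq> {}"
  proof (intro allI impI)
    fix s m assume "finite (s :: real set)"
    then have "\<exists>y. y \<in> A \<and> y \<in> nb a s m"
      using A openin_nb[of s a m] by (auto simp: in_closure_of)
    then show "nb a s m \<inter> A \<noteq> {}" by blast
  qed
next
  assume A: "\<forall>s m. finite s \<longrightarrow> nb a s m \<inter> A \<noteq> {}"
  show "pt a \<in> X closure_of A"
    unfolding in_closure_of
  proof (intro conjI allI impI)
    fix W assume "pt a \<in> W \<and> openin X W"
    then obtain s m where "finite s" "nb a s m \<subseteq> W" unfolding openin_X by blast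
    then show "\<exists>y. y \<in> A \<and> y \<in> W" using A by blast
  qed simp
qed

section \<open>Countable tightness\<close>

lemma countable_dense_columns:
  obtains B where "B \<subseteq> A" "countable B"
    "\<And>n u k. col n u \<in> A \<Longrightarrow> \<exists>w. agree k u w \<and> col n w \<in> B"
proof -
  \<comment> \<open>One representative is taken for each column and each finite word that occurs as
    an initial segment: the columns are second countable.\<close>
  define P where "P n l w \<longleftrightarrow> col n w \<in> A \<and> map w [0..<length l] = l" for n l w
  define B where "B = (\<lambda>(n, l). col n (SOME w. P n l w)) ` {(n, l). \<exists>w. P n l w}"
  have P: "P n l (SOME w. P n l w)" if "P n l w" for n l w
    using that by (rule someI[of "P n l"])
  show thesis
  proof (rule that[of B])
    have PA: "col n w \<in> A" if "P n l w" for n l w using that by (simp add: P_def)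
    show "B \<subseteq> A"
    proof
      fix y assume "y \<in> B"
      then obtain n l w where "P n l w" "y = col n (SOME w. P n l w)" by (auto simp: B_def)
      then show "y \<in> A" using PA[OF P] by simp
    qed
    show "countable B" unfolding B_def by (intro countable_image) simp
    show "\<exists>w. agree k u w \<and> col n w \<in> B" if "col n u \<in> A" for n u k
    proof -
      have u: "P n (map u [0..<k]) u" using that by (simp add: P_def)
      define w where "w = (SOME w. P n (map u [0..<k]) w)"
      have "P n (map u [0..<k]) w" unfolding w_def by (rule P[OF u])
      then have "agree k u w" by (auto simp: P_def agree_def)
      moreover have "col n w \<in> B" unfolding B_def w_def using u by force
      ultimately show ?thesis by blast
    qed
  qed
qed

text \<open>The HFD argument. For every finite \<open>s\<close> a countable infinite set
  \<open>K s\<close> of members of \<open>I\<close> agrees with \<open>a\<close> on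
  \<open>s\<close>, and its members take arbitrary values on finite sets outside a countable
  \<open>H s\<close>. A countable \<open>M\<close> closed under \<open>H\<close> then splits any
  finite set of coordinates into these two kinds.\<close>

lemma countably_tight_pt:
  assumes I: "\<And>s. finite s \<Longrightarrow> \<exists>c\<in>I. \<forall>g\<in>s. p c g = p a g" and "a \<notin> I"
  obtains J where "countable J" "J \<subseteq> I" "\<And>s. finite s \<Longrightarrow> \<exists>c\<in>J. \<forall>g\<in>s. p c g = p a g"
proof -
  define I' where "I' s = {c \<in> I. \<forall>g\<in>s. p c g = p a g}" for s
  \<comment> \<open>Finitely many candidates could all be told apart from \<open>a\<close> by
    finitely many additional coordinates.\<close>
  have inf: "infinite (I' s)" if s: "finite s" for s
  proof
    assume fin: "finite (I' s)"
    have "\<forall>c\<in>I' s. \<exists>g. p c g \<noteq> p a g"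
      using p_separating \<open>a \<notin> I\<close> unfolding I'_def by (metis (lifting) mem_Collect_eq)
    then obtain g where g: "\<And>c. c \<in> I' s \<Longrightarrow> p c (g c) \<noteq> p a (g c)" by metis
    obtain c where "c \<in> I" "\<forall>h\<in>s \<union> g ` I' s. p c h = p a h"
      using I[of "s \<union> g ` I' s"] s fin by blast
    then show False using g[of c] by (auto simp: I'_def)
  qed
  have "\<forall>s. \<exists>K. finite s \<longrightarrow> K \<subseteq> I' s \<and> countable K \<and> infinite K"
    using inf infinite_countable_subset' by metis
  then obtain K where K: "\<And>s. finite s \<Longrightarrow> K s \<subseteq> I' s" "\<And>s. finite s \<Longrightarrow> countable (K s)"
    "\<And>s. finite s \<Longrightarrow> infinite (K s)" by metis
  have "\<forall>s. \<exists>H. finite s \<longrightarrow> countable H \<and> (\<forall>t f. finite t \<and> t \<inter> H = {} \<longrightarrow>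
      (\<exists>q\<in>K s. \<forall>d\<in>t. p q d = f d))"
    using p_finally_dense K by metis
  then obtain H where H: "\<And>s. finite s \<Longrightarrow> countable (H s)"
    "\<And>s t f. finite s \<Longrightarrow> finite t \<Longrightarrow> t \<inter> H s = {} \<Longrightarrow> \<exists>q\<in>K s. \<forall>d\<in>t. p q d = f d" by metis
  define h where "h s = (if finite s then H s else {})" for s
  have "countable (h s)" for s by (simp add: h_def H(1))
  then obtain M where M: "countable M" "\<And>s. finite s \<Longrightarrow> s \<subseteq> M \<Longrightarrow> h s \<subseteq> M"
    using closing_off[of h] by blast
  define J where "J = (\<Union>s\<in>{s. s \<subseteq> M \<and> finite s}. K s)"
  have "countable {s. s \<subseteq> M \<and> finite s}"
    using countable_Collect_finite_subset[OF M(1)] by (simp add: conj_commute)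
  then have "countable J" unfolding J_def using K(2) by (intro countable_UN) auto
  moreover have "J \<subseteq> I" using K(1) by (fastforce simp: J_def I'_def)
  moreover have "\<exists>c\<in>J. \<forall>g\<in>t. p c g = p a g" if t: "finite t" for t
  proof -
    \<comment> \<open>Agreement on \<open>t \<inter> M\<close> is built into \<open>K s\<close>.
      Since \<open>H s \<subseteq> M\<close>, the values on \<open>t - M\<close> may be prescribed
      as those of \<open>a\<close>.\<close>
    define s where "s = t \<inter> M"
    have s: "finite s" "s \<subseteq> M" using t by (auto simp: s_def)
    have "(t - M) \<inter> H s = {}" using M(2)[OF s] s(1) by (auto simp: h_def)
    then obtain q where q: "q \<in> K s" "\<And>d. d \<in> t - M \<Longrightarrow> p q d = p a d"
      using H(2)[of s "t - M" "p a"] s t by auto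
    have "q \<in> I' s" using K(1) q(1) s by blast
    then have "\<forall>g\<in>t. p q g = p a g" using q(2) by (auto simp: I'_def s_def)
    moreover have "q \<in> J" using q(1) s by (auto simp: J_def)
    ultimately show ?thesis by blast
  qed
  ultimately show thesis by (rule that)
qed

lemma countably_tight_X: "countably_tight X"
  unfolding countably_tight_def
proof (intro allI impI)
  fix A x assume A: "A \<subseteq> topspace X \<and> x \<in> X closure_of A"
  obtain B where B: "B \<subseteq> A" "countable B"
    "\<And>n u k. col n u \<in> A \<Longrightarrow> \<exists>w. agree k u w \<and> col n w \<in> B"
    using countable_dense_columns by blast
  have "x \<in> points" using A by (auto simp: in_closure_of)
  then show "\<exists>B. B \<subseteq> A \<and> countable B \<and> x \<in> X closure_of B"
  proof (cases rule: points_cases)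
    case (col n t)
    then have "x \<in> X closure_of B"
      using A B(3) by (auto simp: in_closure_col) (meson agree_trans)
    then show ?thesis using B by blast
  next
    case (pt a)
    show ?thesis
    \<comment> \<open>Either the members of \<open>A\<close> outside the columns already accumulate
      at \<open>pt a\<close>, or some \<open>s0\<close> excludes them all and the countable part
      \<open>B\<close> of the columns suffices.\<close>
    proof (cases "\<forall>s. finite s \<longrightarrow> (\<exists>c\<in>{c. pt c \<in> A}. \<forall>g\<in>s. p c g = p a g)")
      case True
      show ?thesis
      proof (cases "pt a \<in> A")
        case True
        then have "x \<in> X closure_of {pt a}" using pt by (simp add: in_closure_of)
        then show ?thesis using True by (intro exI[of _ "{pt a}"]) simp
      next
        case False
        then obtain J where J: "countable J" "J \<subseteq> {c. pt c \<in> A}"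
          "\<And>s. finite s \<Longrightarrow> \<exists>c\<in>J. \<forall>g\<in>s. p c g = p a g"
          using countably_tight_pt[of "{c. pt c \<in> A}" a] True by auto
        have "x \<in> X closure_of (pt ` J)"
          unfolding pt in_closure_pt
        proof (intro allI impI)
          fix s m assume "finite (s :: real set)"
          then obtain c where "c \<in> J" "\<forall>g\<in>s. p c g = p a g" using J(3) by blast
          then have "pt c \<in> nb a s m \<inter> pt ` J" by simp
          then show "nb a s m \<inter> pt ` J \<noteq> {}" by blast
        qed
        then show ?thesis using J by (intro exI[of _ "pt ` J"]) auto
      qed
    next
      case False
      then obtain s0 where s0: "finite s0" "\<And>c. pt c \<in> A \<Longrightarrow> \<exists>g\<in>s0. p c g \<noteq> p a g" by auto
      have "x \<in> X closure_of B"
        unfolding pt in_closure_pt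
      proof (intro allI impI)
        fix s m assume s: "finite (s :: real set)"
        then obtain y where y: "y \<in> nb a (s \<union> s0) m" "y \<in> A"
          using A s0(1) by (auto simp: pt in_closure_pt) (metis Int_iff all_not_in_conv finite_UnI)
        have "y \<in> points" using y(1) nb_subset_points by blast
        then obtain n u where yc: "y = col n u"
          by (cases rule: points_cases) (use y s0(2) in auto)
        obtain k where k: "\<And>w. agree k u w \<Longrightarrow> \<forall>g\<in>s. ((n, u) \<in> Z g) = ((n, w) \<in> Z g)"
          using uniform_level[OF s, of n] by blast
        obtain w where "agree k u w" "col n w \<in> B" using B(3) y(2) yc by blast
        then have "col n w \<in> nb a s m \<inter> B" using k[of w] y(1) yc by auto
        then show "nb a s m \<inter> B \<noteq> {}" by blast
      qed
      then show ?thesis using B by blast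
    qed
  qed
qed

lemma nice_X: "nice_space X"
  by (simp add: nice_space_def countably_tight_X zero_dim_X Hausdorff_X)

section \<open>Criteria for selective pseudocompactness and for its failure\<close>

lemma openin_contains_cyl:
  assumes "openin X W" "W \<noteq> {}"
  shows "\<exists>n t k. cyl n t k \<subseteq> W"
proof -
  obtain x where x: "x \<in> W" using assms(2) by blast
  then have "x \<in> points" using assms(1) by (auto simp: openin_X)
  then have "\<exists>n t. col n t \<in> W"
  proof (cases rule: points_cases)
    case (pt a)
    then obtain s m where s: "finite s" "nb a s m \<subseteq> W" using x assms(1) unfolding openin_X by blast
    \<comment> \<open>Density of the columns: \<open>p_dense\<close> makes every neighbourhood of
      \<open>pt a\<close> meet them.\<close>
    obtain n where n: "n \<ge> m" "Lg (Suc 0) ({x. \<forall>g\<in>s. (x \<in> Z g) = p a g} `` {n})"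
      using p_dense[OF s(1), of a] unfolding large_def by blast
    then obtain u where "\<forall>g\<in>s. ((n, u) \<in> Z g) = p a g" using Lg_nonempty by blast
    then have "col n u \<in> nb a s m" using n(1) by simp
    then show ?thesis using s(2) by blast
  qed (use x in auto)
  then show ?thesis using assms(1) unfolding openin_X by blast
qed

lemma column_compact:
  fixes u :: "nat \<Rightarrow> nat \<Rightarrow> bool"
  assumes "infinite N"
  obtains t where "\<And>k. infinite {i \<in> N. agree k t (u i)}"
proof -
  have "\<exists>v. \<forall>s. finite s \<and> s \<subseteq> UNIV \<longrightarrow> infinite {i \<in> N. \<forall>j\<in>s. (i \<in> {i. u i j}) = v j}"
  proof (rule coherent_choice[where big = infinite])
    fix M K :: "nat set"
    assume "infinite M"
    then show "infinite (M \<inter> K) \<or> infinite (M - K)" by (metis Int_Diff_Un finite_UnI)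
  qed (use assms in \<open>auto dest: finite_subset\<close>)
  then obtain v where v: "\<And>s. finite s \<Longrightarrow> infinite {i \<in> N. \<forall>j\<in>s. u i j = v j}" by auto
  have "{i \<in> N. agree k v (u i)} = {i \<in> N. \<forall>j\<in>{..<k}. u i j = v j}" for k
    by (auto simp: agree_def)
  then have "infinite {i \<in> N. agree k v (u i)}" for k
    using v[of "{..<k}"] by simp
  then show thesis by (rule that)
qed

text \<open>If infinitely many of the open sets contain cylinders of one column, compactness of that
  column and singletons suffice. Otherwise each column is used finitely often, the selected sets
  together form a large set, and \<open>p_realizes\<close> provides the accumulation point.\<close>

lemma selectively_pseudocompactI:
  assumes single: "\<And>n t. {col n t} \<in> \<AA>"
    and select: "\<And>n t k r. \<exists>A. A \<subseteq> {u. agree k t u} \<inter> finite_support \<and> Lg r A \<and> col n ` A \<in> \<AA>"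
  shows "selectively_pseudocompact_wrt X \<AA>"
  unfolding selectively_pseudocompact_wrt_def
proof (intro allI impI)
  fix U :: "nat \<Rightarrow> real set set"
  assume U: "(\<forall>n. openin X (U n) \<and> U n \<noteq> {}) \<and> (\<forall>m n. m \<noteq> n \<longrightarrow> U m \<inter> U n = {})"
  have "\<forall>i. \<exists>n t k. cyl n t k \<subseteq> U i"
    using U openin_contains_cyl by blast
  then obtain c t k where c: "\<And>i. cyl (c i) (t i) (k i) \<subseteq> U i" by metis
  show "\<exists>A. (\<forall>n. A n \<in> \<AA> \<and> A n \<subseteq> U n) \<and> (\<exists>x. accumulation_point_of_seq X A x)"
  proof (cases "\<exists>n. infinite {i. c i = n}")
    case True
    then obtain n where n: "infinite {i. c i = n}" ..
    obtain w where w: "\<And>j. infinite {i \<in> {i. c i = n}. agree j w (t i)}"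
      using column_compact[OF n, of t] by blast
    define A where "A i = {col (c i) (t i)}" for i
    have "accumulation_point_of_seq X A (col n w)"
      unfolding accumulation_point_of_seq_def
    proof (intro conjI allI impI)
      fix W assume "openin X W \<and> col n w \<in> W"
      then obtain j where j: "cyl n w j \<subseteq> W" unfolding openin_X by blast
      have "{i \<in> {i. c i = n}. agree j w (t i)} \<subseteq> {i. W \<inter> A i \<noteq> {}}"
        using j by (auto simp: A_def cyl_def)
      then show "infinite {i. W \<inter> A i \<noteq> {}}" using w finite_subset by blast
    qed simp
    moreover have "A i \<subseteq> U i" for i using c[of i] by (auto simp: A_def cyl_def)
    ultimately show ?thesis using single by (intro exI[of _ A]) (auto simp: A_def)
  next
    case False
    then have fin: "finite {i. c i = n}" for n by blast
    \<comment> \<open>The grade grows with the index \<open>i\<close>, which makes the union of the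
      selection large.\<close>
    have "\<forall>i. \<exists>A. A \<subseteq> {u. agree (k i) (t i) u} \<inter> finite_support \<and> Lg i A \<and> col (c i) ` A \<in> \<AA>"
      using select by blast
    then obtain A where A: "\<And>i. A i \<subseteq> {u. agree (k i) (t i) u} \<inter> finite_support" "\<And>i. Lg i (A i)"
      "\<And>i. col (c i) ` A i \<in> \<AA>" by metis
    define B where "B = {(n, u). \<exists>i. c i = n \<and> u \<in> A i}"
    have "large B"
      unfolding large_def
    proof (intro allI)
      fix r m
      have "finite (\<Union>n\<in>{..<m}. {i. c i = n})" using fin by blast
      then obtain i where "i \<notin> (\<Union>n\<in>{..<m}. {i. c i = n}) \<union> {..<r}"
        by (metis finite_UnI finite_lessThan ex_new_if_finite infinite_UNIV_nat)
      then have i: "c i \<ge> m" "i \<ge> r" by auto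
      have "Lg r (A i)" using A(2) i(2) by (rule Lg_le)
      moreover have "A i \<subseteq> B `` {c i}" by (auto simp: B_def)
      ultimately show "\<exists>n\<ge>m. Lg r (B `` {n})" using i(1) Lg_mono by blast
    qed
    moreover have "B \<subseteq> UNIV \<times> finite_support" using A(1) by (auto simp: B_def)
    ultimately have "\<exists>a. \<forall>s. finite s \<longrightarrow> large {x \<in> B. \<forall>g\<in>s. (x \<in> Z g) = p a g}"
      by (rule p_realizes)
    then obtain a where
      a: "\<And>s. finite s \<Longrightarrow> large {x \<in> B. \<forall>g\<in>s. (x \<in> Z g) = p a g}" by blast
    have "accumulation_point_of_seq X (\<lambda>i. col (c i) ` A i) (pt a)"
      unfolding accumulation_point_of_seq_def
    proof (intro conjI allI impI)
      fix W assume "openin X W \<and> pt a \<in> W"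
      then obtain s m where s: "finite s" "nb a s m \<subseteq> W" unfolding openin_X by blast
      show "infinite {i. W \<inter> col (c i) ` A i \<noteq> {}}"
        unfolding infinite_nat_iff_unbounded_le
      proof
        fix N
        \<comment> \<open>Beyond column \<open>M\<close> none of the first \<open>N\<close> selected
          sets is met, so the index found there is at least \<open>N\<close>.\<close>
        obtain M where M: "\<And>i. i < N \<Longrightarrow> c i < M"
          using finite_nat_set_iff_bounded[of "c ` {..<N}"] by auto
        obtain n where n: "n \<ge> max m M" "Lg (Suc 0) ({x \<in> B. \<forall>g\<in>s. (x \<in> Z g) = p a g} `` {n})"
          using a[OF s(1)] unfolding large_def by blast
        then obtain u where u: "(n, u) \<in> B" "\<forall>g\<in>s. ((n, u) \<in> Z g) = p a g"
          using Lg_nonempty by blast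
        then obtain i where i: "c i = n" "u \<in> A i" by (auto simp: B_def)
        have "i \<ge> N" using M[of i] i(1) n(1) by (meson leI leD max.boundedE)
        moreover have "col n u \<in> W" using u(2) n(1) s(2) by (meson col_in_nb max.boundedE subsetD)
        ultimately show "\<exists>i\<ge>N. i \<in> {i. W \<inter> col (c i) ` A i \<noteq> {}}" using i by auto
      qed
    qed simp
    moreover have "col (c i) ` A i \<subseteq> U i" for i
      using A(1)[of i] c[of i] by (auto simp: cyl_def)
    ultimately show ?thesis
      using A(3) by (intro exI[of _ "\<lambda>i. col (c i) ` A i"] conjI allI exI[of _ "pt a"])
  qed
qed

text \<open>The columns themselves are the bad sequence. Any admissible choice in them is covered by
  closed small sets, and \<open>p_avoids\<close> gives each \<open>pt a\<close> a neighbourhood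
  missing all of these; a point of a column has that column as a neighbourhood, which meets at most
  one chosen set.\<close>

lemma not_selectively_pseudocompactI:
  assumes "\<And>A n. A \<in> \<AA> \<Longrightarrow> A \<subseteq> range (col n) \<Longrightarrow> \<exists>S. small S \<and> cantor_closed S \<and> A \<subseteq> col n ` S"
  shows "\<not> selectively_pseudocompact_wrt X \<AA>"
proof
  assume sp: "selectively_pseudocompact_wrt X \<AA>"
  have column: "range (col n) = cyl n (\<lambda>_. False) 0" for n
    by (auto simp: cyl_def agree_def)
  have "openin X (range (col n))" for n unfolding column by (rule openin_cyl)
  moreover have "range (col m) \<inter> range (col n) = {}" if "m \<noteq> n" for m n using that by auto
  ultimately have "(\<forall>n. openin X (range (col n)) \<and> range (col n) \<noteq> {}) \<and>
      (\<forall>m n. m \<noteq> n \<longrightarrow> range (col m) \<inter> range (col n) = {})"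
    by simp
  then have "\<exists>A. (\<forall>n. A n \<in> \<AA> \<and> A n \<subseteq> range (col n)) \<and> (\<exists>x. accumulation_point_of_seq X A x)"
    by (rule sp[unfolded selectively_pseudocompact_wrt_def, THEN spec[of _ "\<lambda>n. range (col n)"], THEN mp])
  then obtain A x where A: "\<forall>n. A n \<in> \<AA> \<and> A n \<subseteq> range (col n)"
    and x: "accumulation_point_of_seq X A x" by (elim exE conjE)
  have "\<forall>n. \<exists>S. small S \<and> cantor_closed S \<and> A n \<subseteq> col n ` S"
    using assms A by simp
  then obtain S where S: "\<And>n. small (S n)" "\<And>n. cantor_closed (S n)" "\<And>n. A n \<subseteq> col n ` S n"
    by metis
  have "x \<in> points" using x by (simp add: accumulation_point_of_seq_def)
  then obtain W where "openin X W" "x \<in> W" "finite {n. W \<inter> A n \<noteq> {}}"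
  proof (cases rule: points_cases)
    case (col n t)
    have "m = n" if "cyl n t 0 \<inter> A m \<noteq> {}" for m using spec[OF A, of m] that by (auto simp: cyl_def)
    then have "{m. cyl n t 0 \<inter> A m \<noteq> {}} \<subseteq> {n}" by blast
    then have "finite {m. cyl n t 0 \<inter> A m \<noteq> {}}" by (rule finite_subset) simp
    then show thesis using that[of "cyl n t 0"] openin_cyl col by simp
  next
    case (pt a)
    obtain g where g: "p a g" "\<And>n. Z g `` {n} \<inter> S n = {}" using p_avoids[of S a] S by blast
    have "nb a {g} 0 \<inter> A n = {}" for n
    proof -
      have "col n u \<notin> nb a {g} 0" if "u \<in> S n" for u
        using g(1) g(2)[of n] that by auto
      then show ?thesis using S(3)[of n] by blast
    qed
    then show thesis using that[of "nb a {g} 0"] openin_nb pt by simp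
  qed
  then show False using x by (auto simp: accumulation_point_of_seq_def)
qed

end

section \<open>The matrix under the continuum hypothesis\<close>

text \<open>The cardinal order of the reals: its proper initial segments have smaller cardinality
  than the reals, hence are countable by \<open>CH\<close>.\<close>

lemma CH_omega1_order:
  assumes CH
  shows "\<exists>lt. omega1_order lt"
proof -
  define r where "r = card_of (UNIV :: real set)"
  define lt where "lt x y \<longleftrightarrow> (x, y) \<in> r - Id" for x y
  have r: "well_order_on UNIV r" by (simp add: r_def card_of_well_order_on)
  then have lin: "linear_order_on UNIV r" and wf: "wf (r - Id)"
    by (auto simp: well_order_on_def)
  have tr: "trans r" and an: "antisym r" and tot: "total_on UNIV r"
    using lin by (auto simp: linear_order_on_def partial_order_on_def preorder_on_def)
  have "omega1_order lt"
  proof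
    show "wf {(x, y). lt x y}"
    proof -
      have "{(x, y). lt x y} = r - Id" by (auto simp: lt_def)
      then show ?thesis using wf by simp
    qed
    show "lt x z" if "lt x y" "lt y z" for x y z
      using that tr an by (auto simp: lt_def dest: transD antisymD)
    show "lt x y \<or> x = y \<or> lt y x" for x y
      using tot by (auto simp: lt_def total_on_def)
    show "countable {x. lt x y}" for y
    proof -
      have "(card_of (underS r y), r) \<in> ordLess"
        unfolding r_def by (rule card_of_underS[OF card_of_Card_order]) (simp add: Field_card_of)
      then have "(card_of (underS r y), r) \<notin> ordIso" by (rule not_ordLess_ordIso)
      then have "\<not> underS r y \<approx> (UNIV :: real set)"
        unfolding r_def eqpoll_def card_of_ordIso .
      then have "countable (underS r y)" using assms by (auto simp: CH_def)
      moreover have "underS r y = {x. lt x y}" by (auto simp: underS_def lt_def)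
      ultimately show ?thesis by simp
    qed
  qed
  then show ?thesis by blast
qed

lemma real_codes_sets:
  obtains c :: "real \<Rightarrow> 'a::countable set" where "surj c"
proof -
  obtain f :: "nat set \<Rightarrow> real" where f: "bij f"
    using nat_sets_eqpoll_reals unfolding eqpoll_def by blast
  define c :: "real \<Rightarrow> 'a set" where "c x = {y. to_nat y \<in> inv f x}" for x
  have "c (f (to_nat ` Y)) = Y" for Y
    using f by (auto simp: c_def bij_is_inj)
  then have "surj c" by (rule surjI)
  then show thesis by (rule that)
qed

text \<open>A sequence of subsets of the naturals is the same as one set of pairs.\<close>

lemma real_codes_sequences:
  obtains g :: "real \<Rightarrow> nat \<Rightarrow> real" where "surj g"
proof -
  obtain f :: "nat set \<Rightarrow> real" where f: "bij f"
    using nat_sets_eqpoll_reals unfolding eqpoll_def by blast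
  define g where "g x n = f {k. prod_encode (n, k) \<in> inv f x}" for x n
  have "g (f {prod_encode (n, k) | n k. k \<in> inv f (h n)}) = h" for h
    using f by (auto simp: g_def bij_is_inj bij_is_surj surj_f_inv_f)
  then have "surj g" by (rule surjI)
  then show thesis by (rule that)
qed

context largeness
begin

text \<open>Each real \<open>a\<close> codes a sequence \<open>g a\<close>. Its entry 0 codes the
  promise of point \<open>a\<close>, entry 1 the selection to avoid, entries 2 and 3 the two points
  to separate, and its range is the set to be made finally dense.\<close>

lemma matrix_space_exists:
  assumes CH
  shows "\<exists>Z p. matrix_space Lg small Z p"
proof -
  obtain lt where "omega1_order lt" using CH_omega1_order[OF assms] ..
  then interpret omega1_order lt .
  obtain dec :: "real \<Rightarrow> (nat \<times> bool list) set" where dec: "surj dec" by (rule real_codes_sets)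
  obtain g :: "real \<Rightarrow> nat \<Rightarrow> real" where g: "surj g" by (rule real_codes_sequences)
  \<comment> \<open>Finite words serve in two ways: \<open>ext l\<close> is the finitely supported
    point with initial segment \<open>l\<close>, and \<open>pre l\<close> the cylinder of
    \<open>l\<close>.\<close>
  define ext where "ext l i \<longleftrightarrow> i < length l \<and> l ! i" for l :: "bool list" and i
  define pre where "pre l t \<longleftrightarrow> map t [0..<length l] = l" for l :: "bool list" and t
  \<comment> \<open>Codes of sets that are not large are replaced by the default
    \<open>UNIV\<close>.\<close>
  define A where "A a = (let K = {(n, ext l) | n l. (n, l) \<in> dec (g a 0)} in
    if large K then K else UNIV)" for a
  \<comment> \<open>A closed set is coded by the words whose cylinders miss it; illegitimate codes
    give the empty selection.\<close>
  define T where "T a = (let S = (\<lambda>n. {t. \<forall>l. (n, l) \<in> dec (g a 1) \<longrightarrow> \<not> pre l t}) in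
    if \<forall>n. small (S n) then S else (\<lambda>_. {}))" for a
  define b where "b a = g a 2" for a
  define b' where "b' a = g a 3" for a
  interpret construction Lg small lt A T b b' "\<lambda>a. range (g a)"
  proof
    show "large (A a)" for a by (simp add: A_def Let_def large_UNIV)
    show "small (T a n)" for a n by (simp add: T_def Let_def small_empty)
  qed
  obtain Z p where clop: "\<forall>g n. clopen (Z g `` {n})"
    and real: "\<forall>a s. finite s \<longrightarrow> large {x \<in> A a. \<forall>g\<in>s. (x \<in> Z g) = p a g}"
    and pb: "\<forall>g. lt (b g) g \<longrightarrow> p (b g) g"
    and pb': "\<forall>g. lt (b' g) g \<and> b g \<noteq> b' g \<longrightarrow> \<not> p (b' g) g"
    and ZT: "\<forall>g n. Z g `` {n} \<inter> T g n = {}"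
    and hfd: "\<forall>x. countable (range (g x)) \<and> infinite (range (g x)) \<longrightarrow>
      (\<exists>h. \<forall>t f. finite t \<and> t \<inter> upto h = {} \<longrightarrow> infinite {q \<in> range (g x). \<forall>d\<in>t. p q d = f d})"
    using matrix_exists by (elim exE conjE)
  have avoid: "\<exists>h. p a h \<and> (a \<noteq> c \<longrightarrow> \<not> p c h) \<and> (\<forall>n. Z h `` {n} \<inter> S n = {})"
    if S: "\<And>n. small (S n)" "\<And>n. cantor_closed (S n)" for a c S
  proof -
    define W where "W = {(n, l). \<forall>t\<in>S n. \<not> pre l t}"
    obtain w where "dec w = W" using surjD[OF dec, of W] by auto
    then have w: "dec w = {(n, l). \<forall>t\<in>S n. \<not> pre l t}" by (simp add: W_def)
    have SW: "{t. \<forall>l. (n, l) \<in> dec w \<longrightarrow> \<not> pre l t} = S n" for n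
    proof (intro equalityI subsetI)
      fix t assume t: "t \<in> {t. \<forall>l. (n, l) \<in> dec w \<longrightarrow> \<not> pre l t}"
      have "\<exists>u\<in>S n. agree k t u" for k
      proof -
        have "pre (map t [0..<k]) t" by (simp add: pre_def)
        then obtain u where "u \<in> S n" "pre (map t [0..<k]) u" using t by (auto simp: w)
        then show ?thesis by (intro bexI[of _ u]) (auto simp: pre_def agree_def)
      qed
      then show "t \<in> S n" using S(2)[of n] by (simp add: cantor_closed_def)
    qed (auto simp: w)
    \<comment> \<open>Entry 0 is left free, so that the requirement has uncountably many codes. One
      of them lies beyond both \<open>a\<close> and \<open>c\<close>, where the prescribed values
      are entries of the matrix.\<close>
    define seq where "seq y = (\<lambda>_ :: nat. y)(1 := w, 2 := a, 3 := c)" for y :: real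
    define x where "x y = inv g (seq y)" for y
    have x: "g (x y) = seq y" for y by (simp add: x_def surj_f_inv_f[OF g])
    have "inj x"
    proof (rule injI)
      fix y z assume "x y = x z"
      then have "seq y 0 = seq z 0" using x[of y] x[of z] by simp
      then show "y = z" by (simp add: seq_def)
    qed
    then have "uncountable (range x)" using uncountable_UNIV_real by (metis countable_image_inj_eq)
    then obtain y where y: "lt a (x y)" "lt c (x y)"
      using countable_bounded[of "{a, c}" "range x"] by auto
    have b: "b (x y) = a" "b' (x y) = c" "g (x y) 1 = w" by (simp_all add: b_def b'_def x seq_def)
    have "T (x y) = S" using S(1) SW by (simp add: T_def b(3)[unfolded One_nat_def])
    moreover have "p a (x y)" using spec[OF pb, of "x y"] y(1) b(1) by simp
    moreover have "\<not> p c (x y)" if "a \<noteq> c" using spec[OF pb', of "x y"] y(2) b that by simp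
    ultimately show ?thesis using spec[OF ZT, of "x y"] by (intro exI[of _ "x y"]) simp
  qed
  have "matrix_space Lg small Z p"
  proof
    show "clopen (Z h `` {n})" for h n using clop by blast
    show "large {x. \<forall>g\<in>s. (x \<in> Z g) = p a g}" if "finite s" for s a
      using real[rule_format, OF that, of a] by (rule large_mono) blast
    show "\<exists>h. p a h \<noteq> p c h" if "a \<noteq> c" for a c
      using avoid[of "\<lambda>_. {}" a c] that small_empty by (auto simp: cantor_closed_def)
    show "\<exists>H. countable H \<and> (\<forall>t f. finite t \<and> t \<inter> H = {} \<longrightarrow> (\<exists>q\<in>K. \<forall>d\<in>t. p q d = f d))"
      if K: "countable K" "infinite K" for K
    proof -
      obtain x where "g x = from_nat_into K" using surjD[OF g, of "from_nat_into K"] by auto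
      then have "range (g x) = K" using K by (simp add: range_from_nat_into infinite_imp_nonempty)
      then obtain h where h: "\<And>t f. finite t \<and> t \<inter> upto h = {} \<Longrightarrow> infinite {q \<in> K. \<forall>d\<in>t. p q d = f d}"
        using spec[OF hfd, of x] K by auto
      have "\<exists>q\<in>K. \<forall>d\<in>t. p q d = f d" if "finite t \<and> t \<inter> upto h = {}" for t f
        using infinite_imp_nonempty[OF h[OF that, of f]] by blast
      then show ?thesis using countable_upto[of h] by blast
    qed
    show "\<exists>a. \<forall>s. finite s \<longrightarrow> large {x \<in> B. \<forall>g\<in>s. (x \<in> Z g) = p a g}"
      if B: "large B" "B \<subseteq> UNIV \<times> finite_support" for B
    proof -
      define W where "W = {(n, l). (n, ext l) \<in> B}"
      obtain w where "dec w = W" using surjD[OF dec, of W] by auto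
      then have w: "dec w = {(n, l). (n, ext l) \<in> B}" by (simp add: W_def)
      obtain a where a: "g a = (\<lambda>_. w)" using surjD[OF g, of "\<lambda>_. w"] by auto
      have "{(n, ext l) | n l. (n, l) \<in> dec w} = B"
      proof (intro equalityI subsetI)
        fix x assume x: "x \<in> B"
        obtain n t where nt: "x = (n, t)" by (cases x)
        then have "finite {i. t i}" using x B(2) by (auto simp: finite_support_def)
        then obtain k where k: "\<And>i. t i \<Longrightarrow> i < k" by (auto simp: finite_nat_set_iff_bounded)
        have "ext (map t [0..<k]) i = t i" for i using k[of i] by (auto simp: ext_def)
        then have "ext (map t [0..<k]) = t" by blast
        then show "x \<in> {(n, ext l) | n l. (n, l) \<in> dec w}"
          using x nt by (auto simp: w intro!: exI[of _ "map t [0..<k]"])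
      qed (auto simp: w)
      then have "A a = B" using B(1) by (simp add: A_def Let_def a)
      then show ?thesis using spec[OF real, of a] by auto
    qed
    show "\<exists>h. p a h \<and> (\<forall>n. Z h `` {n} \<inter> S n = {})"
      if "\<And>n. small (S n)" "\<And>n. cantor_closed (S n)" for S a
      using avoid[OF that, of a a] by auto
  qed
  then show ?thesis by blast
qed

end


section \<open>Closed, scattered and nowhere dense subsets of a column\<close>

text \<open>Dense in itself. Below, \<open>thin\<close> means scattered and \<open>sparse\<close>
  means nowhere dense, all phrased with cylinders.\<close>

definition crowded :: "(nat \<Rightarrow> bool) set \<Rightarrow> bool" where
  "crowded T \<longleftrightarrow> (\<forall>t\<in>T. \<forall>k. \<exists>u\<in>T. u \<noteq> t \<and> agree k t u)"

definition thin :: "(nat \<Rightarrow> bool) set \<Rightarrow> bool" where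
  "thin S \<longleftrightarrow> (\<forall>T. T \<subseteq> S \<and> crowded T \<longrightarrow> T = {})"

definition cl :: "(nat \<Rightarrow> bool) set \<Rightarrow> (nat \<Rightarrow> bool) set" where
  "cl A = {t. \<forall>k. \<exists>u\<in>A. agree k t u}"

definition sparse :: "(nat \<Rightarrow> bool) set \<Rightarrow> bool" where
  "sparse S \<longleftrightarrow> (\<forall>t k. \<exists>u j. agree k t u \<and> (\<forall>w\<in>S. \<not> agree j u w))"

lemma subset_cl: "A \<subseteq> cl A"
  unfolding cl_def using agree_refl by blast

lemma cl_mono: "A \<subseteq> B \<Longrightarrow> cl A \<subseteq> cl B"
  unfolding cl_def by blast

lemma cantor_closed_cl: "cantor_closed (cl A)"
  unfolding cantor_closed_def
proof (intro allI impI)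
  fix t assume t: "\<forall>k. \<exists>u\<in>cl A. agree k t u"
  have "\<exists>w\<in>A. agree k t w" for k
  proof -
    obtain u where u: "u \<in> cl A" "agree k t u" using t by blast
    then obtain w where "w \<in> A" "agree k u w" by (auto simp: cl_def)
    then show ?thesis using agree_trans[OF u(2)] by blast
  qed
  then show "t \<in> cl A" by (simp add: cl_def)
qed

lemma cantor_closed_empty [simp]: "cantor_closed {}"
  by (simp add: cantor_closed_def)

lemma separating_level:
  assumes "finite S" "t \<notin> S"
  shows "\<exists>k. \<forall>u\<in>S. \<not> agree k t u"
  using assms
proof (induction S)
  case (insert u S)
  then obtain k where k: "\<forall>u\<in>S. \<not> agree k t u" by blast
  obtain j where j: "\<not> agree j t u" using insert.prems agree_all_imp_eq[of t u] by blast
  have "\<forall>v\<in>insert u S. \<not> agree (max j k) t v"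
    using j k agree_mono[of "max j k" t _ j] agree_mono[of "max j k" t _ k] by auto
  then show ?case ..
qed simp

lemma cantor_closed_finite:
  assumes "finite S"
  shows "cantor_closed S"
  unfolding cantor_closed_def
proof (intro allI impI, rule ccontr)
  fix t assume t: "\<forall>k. \<exists>u\<in>S. agree k t u" "t \<notin> S"
  then show False using separating_level[OF assms t(2)] by blast
qed

lemma thin_finite:
  assumes "finite S"
  shows "thin S"
  unfolding thin_def
proof (intro allI impI)
  fix T assume T: "T \<subseteq> S \<and> crowded T"
  show "T = {}"
  proof (rule ccontr)
    assume "T \<noteq> {}"
    then obtain t where t: "t \<in> T" by blast
    have "finite (T - {t})" using T assms finite_subset by blast
    then obtain k where k: "\<forall>u\<in>T - {t}. \<not> agree k t u" using separating_level[of "T - {t}" t] by blast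
    obtain u where "u \<in> T" "u \<noteq> t" "agree k t u" using T t unfolding crowded_def by blast
    then show False using k by blast
  qed
qed


context matrix_space
begin

lemma scattered_column_iff: "scattered_set X (col n ` S) \<longleftrightarrow> thin S"
proof
  assume sc: "scattered_set X (col n ` S)"
  show "thin S"
    unfolding thin_def
  proof (intro allI impI)
    fix T assume T: "T \<subseteq> S \<and> crowded T"
    show "T = {}"
    proof (rule ccontr)
      assume "T \<noteq> {}"
      then have "col n ` T \<subseteq> col n ` S \<and> col n ` T \<noteq> {}" using T by blast
      then have "\<exists>x\<in>col n ` T. \<exists>U. openin X U \<and> U \<inter> col n ` T = {x}"
        by (rule sc[unfolded scattered_set_def, THEN conjunct2, THEN spec[of _ "col n ` T"], THEN mp])
      then obtain t U where U: "t \<in> T" "openin X U" "U \<inter> col n ` T = {col n t}" by blast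
      then have "col n t \<in> U" by blast
      then obtain k where "cyl n t k \<subseteq> U" using U(2) unfolding openin_X by blast
      moreover obtain u where u: "u \<in> T" "u \<noteq> t" "agree k t u"
        using T U(1) unfolding crowded_def by blast
      ultimately have "col n u \<in> U \<inter> col n ` T" by (auto simp: cyl_def)
      then show False using U(3) u(2) by simp
    qed
  qed
next
  assume thin: "thin S"
  show "scattered_set X (col n ` S)"
    unfolding scattered_set_def
  proof (intro conjI allI impI)
    show "col n ` S \<subseteq> topspace X" by auto
    fix Y assume Y: "Y \<subseteq> col n ` S \<and> Y \<noteq> {}"
    define T where "T = {t. col n t \<in> Y}"
    have YT: "Y = col n ` T" using Y by (auto simp: T_def)
    then have "T \<subseteq> S" "T \<noteq> {}" using Y by auto
    then have "\<not> crowded T" using thin unfolding thin_def by blast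
    then obtain t k where t: "t \<in> T" "\<And>u. u \<in> T \<Longrightarrow> agree k t u \<Longrightarrow> u = t"
      unfolding crowded_def by blast
    have "x = col n t" if "x \<in> cyl n t k \<inter> Y" for x
    proof -
      obtain u where "x = col n u" "u \<in> T" "agree k t u" using \<open>x \<in> _\<close> by (auto simp: YT cyl_def)
      then show ?thesis using t(2) by simp
    qed
    moreover have Yt: "col n t \<in> Y" using t(1) YT by simp
    ultimately have "cyl n t k \<inter> Y = {col n t}" by auto
    then show "\<exists>y\<in>Y. \<exists>U. openin X U \<and> U \<inter> Y = {y}"
      using Yt openin_cyl by (intro bexI[of _ "col n t"] exI[of _ "cyl n t k"] conjI)
  qed
qed

lemma closedin_column_iff: "closedin X (col n ` S) \<longleftrightarrow> cantor_closed S"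
proof -
  have "closedin X (col n ` S) \<longleftrightarrow> X closure_of (col n ` S) \<subseteq> col n ` S"
  proof -
    have "col n ` S \<subseteq> topspace X" by auto
    then show ?thesis using closure_of_subset_eq[of "col n ` S" X] by blast
  qed
  also have "\<dots> \<longleftrightarrow> cantor_closed S"
  proof
    assume sub: "X closure_of (col n ` S) \<subseteq> col n ` S"
    show "cantor_closed S"
      unfolding cantor_closed_def
    proof (intro allI impI)
      fix t assume "\<forall>k. \<exists>u\<in>S. agree k t u"
      then have "col n t \<in> X closure_of (col n ` S)" unfolding in_closure_col by blast
      then have "col n t \<in> col n ` S" using sub by blast
      then show "t \<in> S" by auto
    qed
  next
    assume S: "cantor_closed S"
    show "X closure_of (col n ` S) \<subseteq> col n ` S"
    proof (rule points_subsetI)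
      show "X closure_of (col n ` S) \<subseteq> points" using closure_of_subset_topspace[of X] by simp
      show "col m t \<in> col n ` S" if "col m t \<in> X closure_of (col n ` S)" for m t
      proof -
        have *: "\<exists>u. agree k t u \<and> col m u \<in> col n ` S" for k
          using that unfolding in_closure_col by blast
        have "m = n" using *[of 0] by auto
        then have "\<exists>u\<in>S. agree k t u" for k using *[of k] by auto
        then show ?thesis using S \<open>m = n\<close> by (simp add: cantor_closed_def)
      qed
      show "pt a \<in> col n ` S" if "pt a \<in> X closure_of (col n ` S)" for a
      proof -
        \<comment> \<open>The neighbourhood of \<open>pt a\<close> that drops columns up to
          \<open>n\<close> misses \<open>S\<close>.\<close>
        have "nb a {} (Suc n) \<inter> col n ` S \<noteq> {}" using that unfolding in_closure_pt by blast
        then show ?thesis by auto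
      qed
    qed
  qed
  finally show ?thesis .
qed

lemma nowhere_dense_column:
  assumes "nowhere_dense_in X (col n ` S)"
  shows "sparse S"
  unfolding sparse_def
proof (rule ccontr)
  assume "\<not> (\<forall>t k. \<exists>u j. agree k t u \<and> (\<forall>w\<in>S. \<not> agree j u w))"
  then obtain t k where tk: "\<And>u j. agree k t u \<Longrightarrow> \<exists>w\<in>S. agree j u w" by blast
  have "cyl n t k \<subseteq> X closure_of (col n ` S)"
  proof
    fix x assume "x \<in> cyl n t k"
    then obtain u where u: "x = col n u" "agree k t u" by (auto simp: cyl_def)
    show "x \<in> X closure_of (col n ` S)"
      using tk[OF u(2)] unfolding u(1) in_closure_col by blast
  qed
  then have "cyl n t k \<subseteq> X interior_of (X closure_of (col n ` S))"
    using openin_cyl by (rule interior_of_maximal)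
  then have "cyl n t k = {}" using assms by (simp add: nowhere_dense_in_def)
  moreover have "col n t \<in> cyl n t k" by simp
  ultimately show False by blast
qed

end


text \<open>With all sets allowed, the hypothesis forbids locally finite sequences of disjoint
  non-empty open sets. An unbounded function would produce one, from slabs of its absolute
  value.\<close>

lemma pseudocompactI:
  assumes "selectively_pseudocompact_wrt X UNIV"
  shows "pseudocompact X"
  unfolding pseudocompact_def
proof (intro allI impI, rule ccontr)
  fix f assume f: "continuous_map X euclideanreal f" and unb: "\<not> bounded (f ` topspace X)"
  have ex: "\<exists>x\<in>topspace X. \<bar>f x\<bar> > M" for M
    using unb unfolding bounded_iff by (metis image_iff leI real_norm_def)
  \<comment> \<open>Steps of more than 2 keep the slabs of radius 1 disjoint and send them to
    infinity.\<close>
  have "\<exists>x. \<forall>n. x n \<in> topspace X \<and> \<bar>f (x (Suc n))\<bar> > \<bar>f (x n)\<bar> + 2"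
    using ex by (intro dependent_nat_choice) auto
  then obtain x where x: "\<And>n. x n \<in> topspace X" "\<And>n. \<bar>f (x (Suc n))\<bar> > \<bar>f (x n)\<bar> + 2" by blast
  have gap: "\<bar>f (x n)\<bar> \<ge> \<bar>f (x m)\<bar> + 2 * real (n - m)" if "m \<le> n" for m n
    using that
  proof (induction rule: dec_induct)
    case (step n)
    then show ?case using x(2)[of n] by (simp add: Suc_diff_le)
  qed simp
  define U where "U n = {y \<in> topspace X. \<bar>\<bar>f y\<bar> - \<bar>f (x n)\<bar>\<bar> < 1}" for n
  have cont: "continuous_map X euclideanreal (\<lambda>y. \<bar>f y\<bar>)"
    using f by (rule continuous_map_real_abs)
  have "openin X (U n)" for n
  proof -
    have "U n = {y \<in> topspace X. \<bar>f y\<bar> \<in> ball \<bar>f (x n)\<bar> 1}"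
      by (auto simp: U_def dist_real_def abs_minus_commute)
    then show ?thesis using openin_continuous_map_preimage[OF cont, of "ball \<bar>f (x n)\<bar> 1"] by simp
  qed
  moreover have "U n \<noteq> {}" for n using x(1)[of n] by (auto simp: U_def)
  moreover have "U m \<inter> U n = {}" if "m \<noteq> n" for m n
    using gap[of m n] gap[of n m] that by (cases "m \<le> n") (auto simp: U_def)
  ultimately have "(\<forall>n. openin X (U n) \<and> U n \<noteq> {}) \<and> (\<forall>m n. m \<noteq> n \<longrightarrow> U m \<inter> U n = {})"
    by simp
  then have "\<exists>A. (\<forall>n. A n \<in> UNIV \<and> A n \<subseteq> U n) \<and> (\<exists>y. accumulation_point_of_seq X A y)"
    by (rule assms[unfolded selectively_pseudocompact_wrt_def, THEN spec[of _ U], THEN mp])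
  then obtain A y where A: "\<forall>n. A n \<in> UNIV \<and> A n \<subseteq> U n" and y: "accumulation_point_of_seq X A y"
    by (elim exE conjE)
  define W where "W = {z \<in> topspace X. \<bar>f z\<bar> \<in> {..<\<bar>f y\<bar> + 1}}"
  have "openin X W"
    unfolding W_def by (rule openin_continuous_map_preimage[OF cont]) simp
  moreover have "y \<in> W" using y by (simp add: W_def accumulation_point_of_seq_def)
  ultimately have inf: "infinite {n. W \<inter> A n \<noteq> {}}"
    using y by (simp add: accumulation_point_of_seq_def)
  moreover have "{n. W \<inter> A n \<noteq> {}} \<subseteq> {n. real n \<le> \<bar>f y\<bar> + 2}"
  proof (intro subsetI CollectI)
    fix n assume "n \<in> {n. W \<inter> A n \<noteq> {}}"
    then obtain z where "z \<in> W" "z \<in> U n" using A by blast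
    then show "real n \<le> \<bar>f y\<bar> + 2" using gap[of 0 n] by (auto simp: W_def U_def)
  qed
  moreover have "finite {n. real n \<le> \<bar>f y\<bar> + 2}"
  proof -
    obtain N where "\<bar>f y\<bar> + 2 < real N" using reals_Archimedean2 by blast
    then have "{n. real n \<le> \<bar>f y\<bar> + 2} \<subseteq> {..<N}" by auto
    then show ?thesis using finite_subset by blast
  qed
  ultimately show False using finite_subset by blast
qed

section \<open>The four notions of largeness\<close>

text \<open>These points converge to the one that continues the first \<open>k\<close> values of
  \<open>t\<close> by false.\<close>

definition spike :: "nat \<Rightarrow> (nat \<Rightarrow> bool) \<Rightarrow> nat \<Rightarrow> nat \<Rightarrow> bool" where
  "spike k t j i \<longleftrightarrow> (if i < k then t i else i = k + j)"

lemma agree_spike [simp]: "agree k t (spike k t j)"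
  by (simp add: agree_def spike_def)

lemma spike_finite_support: "spike k t j \<in> finite_support"
proof -
  have "{i. spike k t j i} \<subseteq> {..<k} \<union> {k + j}" by (auto simp: spike_def)
  then show ?thesis unfolding finite_support_def using finite_subset by auto
qed

lemma inj_spike: "inj (spike k t)"
proof (rule injI)
  fix i j assume eq: "spike k t i = spike k t j"
  have "spike k t i (k + i)" by (simp add: spike_def)
  then have "spike k t j (k + i)" by (simp add: eq)
  then show "i = j" by (simp add: spike_def)
qed

subsection \<open>Cardinality\<close>

definition numerous :: "nat \<Rightarrow> (nat \<Rightarrow> bool) set \<Rightarrow> bool" where
  "numerous r A \<longleftrightarrow> infinite A \<or> r \<le> card A"

lemma largeness_numerous: "largeness numerous (\<lambda>S. \<exists>t. S \<subseteq> {t})"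
proof
  show "numerous r B" if "numerous r A" "A \<subseteq> B" for r A B
    using that by (meson card_mono finite_subset le_trans numerous_def)
  show "numerous r A" if "numerous (Suc r) A" for r A
    using that by (auto simp: numerous_def)
  show "A \<noteq> {}" if "numerous (Suc r) A" for r A
    using that by (auto simp: numerous_def)
  show "numerous r (A \<inter> B) \<or> numerous r (A - B)" if "numerous (r + r) A" for r A B
  proof (cases "finite A")
    case True
    then have "card A = card (A \<inter> B) + card (A - B)" by (simp add: card_Int_Diff)
    then show ?thesis using that True by (auto simp: numerous_def)
  next
    case False
    then have "infinite (A \<inter> B) \<or> infinite (A - B)" by (metis Int_Diff_Un finite_UnI)
    then show ?thesis by (auto simp: numerous_def)
  qed
  show "\<exists>Z. clopen Z \<and> Z \<inter> S = {} \<and> numerous r (A \<inter> Z)"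
    if S: "\<exists>t. S \<subseteq> {t}" and A: "numerous (Suc r) A" for S r A
  proof -
    obtain t where t: "S \<subseteq> {t}" using S ..
    have "\<exists>F. F \<subseteq> A - {t} \<and> finite F \<and> card F = r"
    proof (cases "finite A")
      case True
      then have "r \<le> card (A - {t})" using A by (auto simp: numerous_def card_Diff_singleton_if)
      then show ?thesis by (meson obtain_subset_with_card_n)
    next
      case False
      then have "infinite (A - {t})" by simp
      then show ?thesis using infinite_arbitrarily_large by blast
    qed
    then obtain F where F: "F \<subseteq> A - {t}" "finite F" "card F = r" by blast
    \<comment> \<open>Only \<open>r\<close> of the points other than \<open>t\<close> are retained:
      finitely many points can be cut off from \<open>t\<close> by a single cylinder.\<close>
    then obtain k where k: "\<forall>u\<in>F. \<not> agree k t u" using separating_level[of F t] by blast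
    define Z where "Z = {u. \<not> agree k t u}"
    have "clopen Z" unfolding clopen_def Z_def using agree_trans agree_sym by blast
    moreover have "Z \<inter> S = {}" using t by (auto simp: Z_def)
    moreover have "F \<subseteq> A \<inter> Z" using F k by (auto simp: Z_def)
    then have "numerous r (A \<inter> Z)" using F(3) by (metis card_mono numerous_def)
    ultimately show ?thesis by blast
  qed
  show "numerous r UNIV" for r
    using inj_spike[of 0 "\<lambda>_. False"] finite_subset[OF subset_UNIV]
    by (auto simp: numerous_def dest: range_inj_infinite)
qed auto

subsection \<open>Cantor--Bendixson rank\<close>

text \<open>Equivalently, the \<open>r\<close>-th Cantor-Bendixson derivative of the closure of
  \<open>A\<close> is non-empty. The version with disjoint clopen pieces avoids derivatives and
  suits the avoidance of finite sets.\<close>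

primrec ranked :: "nat \<Rightarrow> (nat \<Rightarrow> bool) set \<Rightarrow> bool" where
  "ranked 0 A \<longleftrightarrow> A \<noteq> {}"
| "ranked (Suc r) A \<longleftrightarrow> (\<exists>Z :: nat \<Rightarrow> (nat \<Rightarrow> bool) set. disjoint_family Z \<and>
    (\<forall>i. clopen (Z i) \<and> ranked r (A \<inter> Z i)))"

lemma ranked_SucI:
  fixes Z :: "nat \<Rightarrow> (nat \<Rightarrow> bool) set"
  assumes "disjoint_family Z" "\<And>i. clopen (Z i)" "\<And>i. ranked r (A \<inter> Z i)"
  shows "ranked (Suc r) A"
  unfolding ranked.simps using assms by (intro exI[of _ Z]) simp

lemma ranked_SucE:
  assumes "ranked (Suc r) A"
  obtains Z :: "nat \<Rightarrow> (nat \<Rightarrow> bool) set"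
  where "disjoint_family Z" "\<forall>i. clopen (Z i)" "\<forall>i. ranked r (A \<inter> Z i)"
proof -
  have "\<exists>Z :: nat \<Rightarrow> (nat \<Rightarrow> bool) set. disjoint_family Z \<and> (\<forall>i. clopen (Z i) \<and> ranked r (A \<inter> Z i))"
    using assms by simp
  then obtain Z :: "nat \<Rightarrow> (nat \<Rightarrow> bool) set" where
    "disjoint_family Z \<and> (\<forall>i. clopen (Z i) \<and> ranked r (A \<inter> Z i))" by (rule exE)
  then show thesis using that[of Z] by simp
qed

lemma ranked_mono: "ranked r A \<Longrightarrow> A \<subseteq> B \<Longrightarrow> ranked r B"
proof (induction r arbitrary: A B)
  case (Suc r)
  obtain Z :: "nat \<Rightarrow> (nat \<Rightarrow> bool) set"
    where Z: "disjoint_family Z" "\<forall>i. clopen (Z i)" "\<forall>i. ranked r (A \<inter> Z i)"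
    using Suc.prems(1) by (rule ranked_SucE)
  note Z = Z[rule_format]
  have "A \<inter> Z i \<subseteq> B \<inter> Z i" for i using Suc.prems(2) by blast
  then have "ranked r (B \<inter> Z i)" for i using Suc.IH[OF Z(3)] by blast
  with Z(1,2) show ?case by (rule ranked_SucI)
qed auto

lemma ranked_nonempty: "ranked r A \<Longrightarrow> A \<noteq> {}"
proof (induction r arbitrary: A)
  case (Suc r)
  obtain Z :: "nat \<Rightarrow> (nat \<Rightarrow> bool) set"
    where Z: "disjoint_family Z" "\<forall>i. clopen (Z i)" "\<forall>i. ranked r (A \<inter> Z i)"
    using Suc.prems by (rule ranked_SucE)
  note Z = Z[rule_format]
  have "A \<inter> Z 0 \<noteq> {}" using Z(3) by (rule Suc.IH)
  then show ?case by blast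
qed simp

lemma ranked_SucD: "ranked (Suc r) A \<Longrightarrow> ranked r A"
proof (induction r arbitrary: A)
  case 0
  then show ?case using ranked_nonempty[of "Suc 0" A] by simp
next
  case (Suc r)
  obtain Z :: "nat \<Rightarrow> (nat \<Rightarrow> bool) set"
    where Z: "disjoint_family Z" "\<forall>i. clopen (Z i)" "\<forall>i. ranked (Suc r) (A \<inter> Z i)"
    using Suc.prems by (rule ranked_SucE)
  note Z = Z[rule_format]
  show ?case using Z(1,2) Suc.IH[OF Z(3)] by (rule ranked_SucI)
qed

text \<open>Two separate grades let the induction on \<open>q\<close> go through: either one piece
  already gives rank \<open>r\<close> to \<open>B\<close>, or every piece gives rank
  \<open>q\<close> to \<open>A\<close>, which raises the rank of \<open>A\<close> by one.\<close>

lemma ranked_split: "ranked (q + r) (A \<union> B) \<Longrightarrow> ranked q A \<or> ranked r B"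
proof (induction q arbitrary: A B)
  case 0
  then show ?case by (cases "A = {}") auto
next
  case (Suc q)
  then have "ranked (Suc (q + r)) (A \<union> B)" by simp
  then obtain Z :: "nat \<Rightarrow> (nat \<Rightarrow> bool) set"
    where Z: "disjoint_family Z" "\<forall>i. clopen (Z i)"
    "\<forall>i. ranked (q + r) ((A \<union> B) \<inter> Z i)" by (rule ranked_SucE)
  note Z = Z[rule_format]
  have split: "ranked q (A \<inter> Z i) \<or> ranked r (B \<inter> Z i)" for i
    using Z(3)[of i] Suc.IH[of "A \<inter> Z i" "B \<inter> Z i"] by (simp add: Int_Un_distrib2)
  show ?case
  proof (cases "\<exists>i. ranked r (B \<inter> Z i)")
    case True
    then show ?thesis using ranked_mono[OF _ Int_lower1] by blast
  next
    case False
    then have "ranked q (A \<inter> Z i)" for i using split by blast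
    with Z(1,2) have "ranked (Suc q) A" by (rule ranked_SucI)
    then show ?thesis ..
  qed
qed

text \<open>The standard compact scattered set of finite rank: at most \<open>r\<close> true entries
  from \<open>k\<close> on.\<close>

definition few :: "nat \<Rightarrow> nat \<Rightarrow> (nat \<Rightarrow> bool) \<Rightarrow> (nat \<Rightarrow> bool) set" where
  "few r k t = {u. agree k t u \<and> finite {i. k \<le> i \<and> u i} \<and> card {i. k \<le> i \<and> u i} \<le> r}"

lemma few_finite_support: "few r k t \<subseteq> finite_support"
proof
  fix u assume "u \<in> few r k t"
  moreover have "{i. u i} \<subseteq> {..<k} \<union> {i. k \<le> i \<and> u i}" by auto
  ultimately show "u \<in> finite_support" unfolding few_def finite_support_def using finite_subset by auto
qed

lemma ranked_few: "ranked r (few r k t)"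
proof (induction r arbitrary: k t)
  case 0
  have "{i. k \<le> i \<and> i < k \<and> t i} = {}" by auto
  then have "(\<lambda>i. i < k \<and> t i) \<in> few 0 k t" by (simp add: few_def agree_def)
  then show ?case by auto
next
  case (Suc r)
  \<comment> \<open>Points are sorted by the position \<open>k + i\<close> of their first true entry
    from \<open>k\<close> on. Fixing it uses up one of the \<open>Suc r\<close> entries and leaves
    \<open>r\<close> from \<open>Suc (k + i)\<close> on.\<close>
  define Z where "Z i = {u. agree (Suc (k + i)) (spike k t i) u}" for i
  have first: "u (k + i) \<longleftrightarrow> i = j" if "u \<in> Z j" "i \<le> j" for u i j
  proof -
    have "spike k t j (k + i) = u (k + i)" using that by (simp add: Z_def agree_def)
    then show ?thesis by (simp add: spike_def)
  qed
  have "i = j" if "u \<in> Z i" "u \<in> Z j" for u i j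
    using first[of u i i] first[of u j j] first[of u i j] first[of u j i] that
    by (cases "i \<le> j") auto
  then have "disjoint_family Z" unfolding disjoint_family_on_def by blast
  have "clopen (Z i)" for i by (simp add: Z_def)
  have sub: "few r (Suc (k + i)) (spike k t i) \<subseteq> few (Suc r) k t \<inter> Z i" for i
  proof
    fix u assume u: "u \<in> few r (Suc (k + i)) (spike k t i)"
    define F where "F = {j. Suc (k + i) \<le> j \<and> u j}"
    have F: "finite F" "card F \<le> r" using u by (auto simp: few_def F_def)
    have ag: "u j = spike k t i j" if "j < Suc (k + i)" for j
      using u that by (simp add: few_def agree_def)
    have "{j. k \<le> j \<and> u j} \<subseteq> insert (k + i) F"
    proof
      fix j assume j: "j \<in> {j. k \<le> j \<and> u j}"
      show "j \<in> insert (k + i) F"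
      proof (cases "j < Suc (k + i)")
        case True
        then show ?thesis using ag[OF True] j by (simp add: spike_def)
      next
        case False
        then show ?thesis using j by (simp add: F_def)
      qed
    qed
    moreover have "finite (insert (k + i) F)" "card (insert (k + i) F) \<le> Suc r"
      using F by (auto simp: card_insert_if)
    ultimately have sub: "{j. k \<le> j \<and> u j} \<subseteq> insert (k + i) F"
      and fin: "finite (insert (k + i) F)" and card: "card (insert (k + i) F) \<le> Suc r" by blast+
    have "finite {j. k \<le> j \<and> u j}" using sub fin by (rule finite_subset)
    moreover have "card {j. k \<le> j \<and> u j} \<le> Suc r"
      using card_mono[OF fin sub] card by simp
    moreover have "agree k t u" using ag by (auto simp: agree_def spike_def)
    ultimately show "u \<in> few (Suc r) k t \<inter> Z i" using u by (simp add: few_def Z_def)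
  qed
  have "ranked r (few (Suc r) k t \<inter> Z i)" for i using Suc.IH sub by (rule ranked_mono)
  then show ?case using \<open>disjoint_family Z\<close> \<open>\<And>i. clopen (Z i)\<close> by (intro ranked_SucI)
qed

lemma cantor_closed_few: "cantor_closed (few r k t)"
  unfolding cantor_closed_def
proof (intro allI impI)
  fix u assume u: "\<forall>j. \<exists>w\<in>few r k t. agree j u w"
  \<comment> \<open>Finitely many true entries of a limit are already present in some member of the
    set.\<close>
  have bound: "card F \<le> r" if F: "finite F" "F \<subseteq> {i. k \<le> i \<and> u i}" for F
  proof -
    obtain m where m: "\<forall>i\<in>F. i < m" using F(1) finite_nat_set_iff_bounded by blast
    obtain w where w: "w \<in> few r k t" "agree m u w" using u by blast
    have "F \<subseteq> {i. k \<le> i \<and> w i}" using F(2) m w(2) by (auto simp: agree_def)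
    then show ?thesis using w(1) card_mono[of "{i. k \<le> i \<and> w i}" F] by (auto simp: few_def)
  qed
  have "finite {i. k \<le> i \<and> u i}"
  proof (rule ccontr)
    assume "infinite {i. k \<le> i \<and> u i}"
    then obtain F where "finite F" "card F = Suc r" "F \<subseteq> {i. k \<le> i \<and> u i}"
      using infinite_arbitrarily_large by blast
    then show False using bound[of F] by simp
  qed
  moreover from this have "card {i. k \<le> i \<and> u i} \<le> r" using bound by blast
  moreover obtain w where "w \<in> few r k t" "agree k u w" using u by blast
  then have "agree k t u" by (auto simp: few_def agree_def)
  ultimately show "u \<in> few r k t" by (simp add: few_def)
qed

text \<open>A member of \<open>T\<close> with the largest number of true entries is isolated:
  another member agreeing with it past its last true entry would have more of them.\<close>

lemma thin_few: "thin (few r k t)"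
  unfolding thin_def
proof (intro allI impI, rule ccontr)
  fix T assume T: "T \<subseteq> few r k t \<and> crowded T" and "T \<noteq> {}"
  then obtain u0 where "u0 \<in> T" by blast
  define c where "c u = card {i. k \<le> i \<and> u i}" for u :: "nat \<Rightarrow> bool"
  have "\<forall>u. u \<in> T \<longrightarrow> c u < Suc r" using T by (auto simp: few_def c_def less_Suc_eq_le)
  with \<open>u0 \<in> T\<close> have "\<exists>u. u \<in> T \<and> (\<forall>w. w \<in> T \<longrightarrow> c w \<le> c u)"
    by (rule Lattices_Big.ex_has_greatest_nat)
  then obtain u where u: "u \<in> T" "\<And>w. w \<in> T \<Longrightarrow> c w \<le> c u" by blast
  have fin: "finite {i. k \<le> i \<and> w i}" if "w \<in> T" for w using that T by (auto simp: few_def)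
  obtain m where m: "\<forall>i\<in>{i. k \<le> i \<and> u i}. i < m"
    using fin[OF u(1)] finite_nat_set_iff_bounded by blast
  obtain w where w: "w \<in> T" "w \<noteq> u" "agree (max k m) u w"
    using T u(1) unfolding crowded_def by blast
  obtain j where j: "w j \<noteq> u j" using w(2) by blast
  have same: "w i = u i" if "i < max k m" for i using w(3) that by (simp add: agree_def)
  then have "max k m \<le> j" using j not_le by blast
  then have "k \<le> j" "\<not> j < m" by auto
  then have "j \<in> {i. k \<le> i \<and> w i}" "j \<notin> {i. k \<le> i \<and> u i}" using j m by auto
  moreover have "{i. k \<le> i \<and> u i} \<subseteq> {i. k \<le> i \<and> w i}"
    using m same by auto
  ultimately have "{i. k \<le> i \<and> u i} \<subset> {i. k \<le> i \<and> w i}" by blast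
  then have "c u < c w" unfolding c_def using fin[OF w(1)] by (rule psubset_card_mono[rotated])
  then show False using u(2)[OF w(1)] by simp
qed

lemma largeness_ranked: "largeness ranked finite"
proof
  show "ranked r B" if "ranked r A" "A \<subseteq> B" for r A B using that by (rule ranked_mono)
  show "ranked r A" if "ranked (Suc r) A" for r A using that by (rule ranked_SucD)
  show "A \<noteq> {}" if "ranked (Suc r) A" for r A using that by (rule ranked_nonempty)
  show "ranked r (A \<inter> B) \<or> ranked r (A - B)" if "ranked (r + r) A" for r A B
    using that by (intro ranked_split) (simp add: Int_Diff_Un)
  show "\<exists>Z. clopen Z \<and> Z \<inter> S = {} \<and> ranked r (A \<inter> Z)" if S: "finite S" "ranked (Suc r) A" for S r A
  proof -
    obtain Z :: "nat \<Rightarrow> (nat \<Rightarrow> bool) set"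
    where Z: "disjoint_family Z" "\<forall>i. clopen (Z i)" "\<forall>i. ranked r (A \<inter> Z i)"
      using S(2) by (rule ranked_SucE)
    note Z = Z[rule_format]
    \<comment> \<open>A finite set cannot meet infinitely many disjoint pieces.\<close>
    have "\<exists>i. Z i \<inter> S = {}"
    proof (rule ccontr)
      assume "\<nexists>i. Z i \<inter> S = {}"
      then have "\<forall>i. \<exists>x. x \<in> Z i \<and> x \<in> S" by blast
      then obtain x where x: "\<And>i. x i \<in> Z i" "\<And>i. x i \<in> S" by metis
      have "inj x"
      proof (rule injI)
        fix i j assume "x i = x j"
        then have "Z i \<inter> Z j \<noteq> {}" using x(1)[of i] x(1)[of j] by auto
        then show "i = j" using Z(1) by (auto simp: disjoint_family_on_def)
      qed
      then have "infinite (range x)" by (rule range_inj_infinite)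
      then show False using x(2) S(1) by (meson finite_subset image_subsetI)
    qed
    then show ?thesis using Z by blast
  qed
  show "ranked r UNIV" for r using ranked_few subset_UNIV by (rule ranked_mono)
qed simp

subsection \<open>Non-scattered closure\<close>

text \<open>The closure matters: a scattered set can be fat, yet no closed scattered set covers a
  fat set.\<close>

definition fat :: "nat \<Rightarrow> (nat \<Rightarrow> bool) set \<Rightarrow> bool" where
  "fat r A \<longleftrightarrow> \<not> thin (cl A)"

lemma fatI: "crowded T \<Longrightarrow> T \<noteq> {} \<Longrightarrow> T \<subseteq> cl A \<Longrightarrow> fat r A"
  by (auto simp: fat_def thin_def)

lemma fatE:
  assumes "fat r A"
  obtains T where "crowded T" "T \<noteq> {}" "T \<subseteq> cl A"
  using assms by (auto simp: fat_def thin_def)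

lemma crowded_Diff:
  assumes "crowded T" "cantor_closed S"
  shows "crowded (T - S)"
  unfolding crowded_def
proof (intro ballI allI)
  fix t k assume t: "t \<in> T - S"
  then obtain j where j: "\<And>u. u \<in> S \<Longrightarrow> \<not> agree j t u"
    using assms(2) unfolding cantor_closed_def by blast
  obtain u where u: "u \<in> T" "u \<noteq> t" "agree (max j k) t u"
    using assms(1) t unfolding crowded_def by blast
  have "agree j t u" using u(3) by (rule agree_mono) simp
  then have "u \<notin> S" using j by blast
  moreover have "agree k t u" using u(3) by (rule agree_mono) simp
  ultimately show "\<exists>u\<in>T - S. u \<noteq> t \<and> agree k t u" using u by blast
qed

text \<open>A discrete set accumulating at the crowded set of all points that vanish at odd offsets
  from \<open>k\<close>.\<close>

definition hedge :: "nat \<Rightarrow> (nat \<Rightarrow> bool) \<Rightarrow> (nat \<Rightarrow> bool) set" where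
  "hedge k t = {u. agree k t u \<and> (\<exists>j. u (k + 2 * j + 1) \<and> (\<forall>i>k + 2 * j + 1. \<not> u i) \<and>
    (\<forall>j'<j. \<not> u (k + 2 * j' + 1)))}"

lemma hedge_finite_support: "hedge k t \<subseteq> finite_support"
proof
  fix u assume "u \<in> hedge k t"
  then obtain j where "\<forall>i>k + 2 * j + 1. \<not> u i" by (auto simp: hedge_def)
  then have "{i. u i} \<subseteq> {..k + 2 * j + 1}" by (auto simp: not_less[symmetric])
  then show "u \<in> finite_support" unfolding finite_support_def using finite_subset by auto
qed

text \<open>The true entry at the first odd offset is also the last true entry. Agreement just past
  it therefore determines the point, so every point is isolated.\<close>

lemma thin_hedge: "thin (hedge k t)"
  unfolding thin_def
proof (intro allI impI, rule ccontr)
  fix T assume T: "T \<subseteq> hedge k t \<and> crowded T" and "T \<noteq> {}"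
  then obtain u where u: "u \<in> T" by blast
  then obtain j where j: "u (k + 2 * j + 1)" "\<forall>i>k + 2 * j + 1. \<not> u i" "\<forall>j'<j. \<not> u (k + 2 * j' + 1)"
    using T by (auto simp: hedge_def)
  obtain w where w: "w \<in> T" "w \<noteq> u" "agree (k + 2 * j + 2) u w"
    using T u unfolding crowded_def by blast
  then obtain l where l: "w (k + 2 * l + 1)" "\<forall>i>k + 2 * l + 1. \<not> w i" "\<forall>j'<l. \<not> w (k + 2 * j' + 1)"
    using T by (auto simp: hedge_def)
  have "w (k + 2 * j + 1)" using w(3) j(1) by (simp add: agree_def)
  then have "\<not> j < l" using l(3) by blast
  moreover have "\<not> l < j"
  proof
    assume "l < j"
    then have "\<not> u (k + 2 * l + 1)" "k + 2 * l + 1 < k + 2 * j + 2" using j(3) by auto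
    then show False using l(1) w(3) by (simp add: agree_def)
  qed
  ultimately have "l = j" by simp
  have "w i = u i" for i
    using j(2) l(2) w(3) \<open>l = j\<close> by (cases "i < k + 2 * j + 2") (auto simp: agree_def)
  then show False using w(2) by blast
qed

lemma fat_hedge: "fat r (hedge k t)"
proof -
  define T where "T = {u. agree k t u \<and> (\<forall>j. \<not> u (k + 2 * j + 1))}"
  have "(\<lambda>i. i < k \<and> t i) \<in> T" by (simp add: T_def agree_def)
  then have "T \<noteq> {}" by blast
  moreover have "crowded T"
    unfolding crowded_def
  proof (intro ballI allI)
    fix u m assume u: "u \<in> T"
    \<comment> \<open>Flipping an even offset at or beyond \<open>m\<close> stays in
      \<open>T\<close>.\<close>
    define w where "w = u(k + 2 * m := \<not> u (k + 2 * m))"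
    have "w (k + 2 * m) \<noteq> u (k + 2 * m)" by (simp add: w_def)
    then have "w \<noteq> u" by auto
    moreover have "agree m u w" by (simp add: w_def agree_def)
    moreover have "w (k + 2 * j + 1) = u (k + 2 * j + 1)" for j
    proof -
      have "k + 2 * j + 1 \<noteq> k + 2 * m" by presburger
      then show ?thesis by (simp add: w_def)
    qed
    then have "w \<in> T" using u by (simp add: T_def agree_def w_def)
    ultimately show "\<exists>w\<in>T. w \<noteq> u \<and> agree m u w" by blast
  qed
  moreover have "T \<subseteq> cl (hedge k t)"
  proof
    fix u assume u: "u \<in> T"
    have "\<exists>w\<in>hedge k t. agree m u w" for m
    proof
      \<comment> \<open>Cutting \<open>u\<close> off with one true entry at the odd offset
        \<open>2 * m + 1\<close> gives a point of \<open>hedge k t\<close>.\<close>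
      define w where "w i \<longleftrightarrow> (if i < k + 2 * m + 1 then u i else i = k + 2 * m + 1)" for i
      show "agree m u w" by (simp add: w_def agree_def)
      have "agree k t w" using u by (simp add: T_def w_def agree_def)
      moreover have "\<not> w (k + 2 * j' + 1)" if "j' < m" for j' using u that by (simp add: T_def w_def)
      moreover have "w (k + 2 * m + 1)" "\<forall>i>k + 2 * m + 1. \<not> w i" by (simp_all add: w_def)
      ultimately show "w \<in> hedge k t" unfolding hedge_def by blast
    qed
    then show "u \<in> cl (hedge k t)" by (simp add: cl_def)
  qed
  ultimately show ?thesis using fatI by blast
qed

lemma largeness_fat: "largeness fat (\<lambda>S. thin S \<and> cantor_closed S)"
proof
  have mono: "fat r B" if "fat r A" "A \<subseteq> B" for r A B
  proof -
    obtain T where "crowded T" "T \<noteq> {}" "T \<subseteq> cl A" using \<open>fat r A\<close> by (rule fatE)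
    then show ?thesis using fatI[of T B] cl_mono[OF \<open>A \<subseteq> B\<close>] by simp
  qed
  then show "fat r B" if "fat r A" "A \<subseteq> B" for r A B using that by blast
  show "fat r A" if "fat (Suc r) A" for r A using that by (simp add: fat_def)
  show "A \<noteq> {}" if "fat (Suc r) A" for r A
    using that by (auto simp: fat_def thin_def cl_def)
  show "fat r (A \<inter> B) \<or> fat r (A - B)" if A: "fat (r + r) A" for r A B
  proof -
    obtain T where T: "crowded T" "T \<noteq> {}" "T \<subseteq> cl A" using A by (rule fatE)
    show ?thesis
    \<comment> \<open>What remains of the crowded set outside the closure of
      \<open>A \<inter> B\<close> is crowded again and lies in the closure of
      \<open>A - B\<close>.\<close>
    proof (cases "T \<subseteq> cl (A \<inter> B)")
      case True
      then show ?thesis using T fatI by blast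
    next
      case False
      have "T - cl (A \<inter> B) \<subseteq> cl (A - B)"
      proof
        fix t assume t: "t \<in> T - cl (A \<inter> B)"
        then obtain j where j: "\<And>u. u \<in> A \<inter> B \<Longrightarrow> \<not> agree j t u" by (auto simp: cl_def)
        have "\<exists>u\<in>A - B. agree k t u" for k
        proof -
          have "t \<in> cl A" using t T(3) by blast
          then obtain u where u: "u \<in> A" "agree (max j k) t u" by (auto simp: cl_def)
          then have "agree j t u" "agree k t u" using agree_mono[OF u(2)] by auto
          then show ?thesis using j u(1) by blast
        qed
        then show "t \<in> cl (A - B)" by (simp add: cl_def)
      qed
      then show ?thesis using fatI[OF crowded_Diff[OF T(1) cantor_closed_cl]] False by blast
    qed
  qed
  show "\<exists>Z. clopen Z \<and> Z \<inter> S = {} \<and> fat r (A \<inter> Z)"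
    if S: "thin S \<and> cantor_closed S" and A: "fat (Suc r) A" for S r A
  proof -
    obtain T where T: "crowded T" "T \<noteq> {}" "T \<subseteq> cl A" using A by (rule fatE)
    \<comment> \<open>A scattered set cannot contain the crowded \<open>T\<close>; closedness of
      \<open>S\<close> then gives a whole cylinder that meets \<open>T\<close> and misses
      \<open>S\<close>.\<close>
    then have "\<not> T \<subseteq> S" using S unfolding thin_def by blast
    then obtain t where t: "t \<in> T" "t \<notin> S" by blast
    then obtain k where k: "\<And>u. u \<in> S \<Longrightarrow> \<not> agree k t u"
      using S unfolding cantor_closed_def by blast
    define Z where "Z = {u. agree k t u}"
    have "crowded (T \<inter> Z)"
      unfolding crowded_def
    proof (intro ballI allI)
      fix u m assume u: "u \<in> T \<inter> Z"
      then obtain w where w: "w \<in> T" "w \<noteq> u" "agree (max k m) u w"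
        using T(1) unfolding crowded_def by blast
      then have "agree k u w" "agree m u w" using agree_mono[OF w(3)] by auto
      moreover from this have "w \<in> Z" using u agree_trans by (auto simp: Z_def)
      ultimately show "\<exists>w\<in>T \<inter> Z. w \<noteq> u \<and> agree m u w" using w by blast
    qed
    moreover have "T \<inter> Z \<noteq> {}" using t by (auto simp: Z_def)
    moreover have "T \<inter> Z \<subseteq> cl (A \<inter> Z)"
    proof
      fix u assume u: "u \<in> T \<inter> Z"
      have "\<exists>w\<in>A \<inter> Z. agree m u w" for m
      proof -
        have "u \<in> cl A" using u T(3) by blast
        then obtain w where w: "w \<in> A" "agree (max k m) u w" by (auto simp: cl_def)
        then have "agree k u w" "agree m u w" using agree_mono[OF w(2)] by auto
        moreover from this have "w \<in> Z" using u agree_trans by (auto simp: Z_def)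
        ultimately show ?thesis using w(1) by blast
      qed
      then show "u \<in> cl (A \<inter> Z)" by (simp add: cl_def)
    qed
    ultimately have "fat r (A \<inter> Z)" by (rule fatI)
    moreover have "Z \<inter> S = {}" using k by (auto simp: Z_def)
    ultimately show ?thesis by (intro exI[of _ Z]) (simp add: Z_def)
  qed
  show "fat r UNIV" for r using fat_hedge subset_UNIV by (rule mono)
  show "thin {} \<and> cantor_closed {}" by (simp add: thin_def)
qed

subsection \<open>Somewhere density\<close>

definition somewhere_dense :: "nat \<Rightarrow> (nat \<Rightarrow> bool) set \<Rightarrow> bool" where
  "somewhere_dense r A \<longleftrightarrow> (\<exists>t k. \<forall>u j. agree k t u \<longrightarrow> (\<exists>w\<in>A. agree j u w))"

lemma somewhere_dense_finite_support: "somewhere_dense r ({u. agree k t u} \<inter> finite_support)"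
  unfolding somewhere_dense_def
proof (intro exI allI impI)
  fix u j assume u: "agree k t u"
  have "agree j u (spike (max j k) u 0)" "agree k u (spike (max j k) u 0)"
    using agree_mono[OF agree_spike[of "max j k" u 0]] by auto
  then show "\<exists>w\<in>{u. agree k t u} \<inter> finite_support. agree j u w"
    using u spike_finite_support agree_trans by blast
qed

lemma largeness_somewhere_dense: "largeness somewhere_dense sparse"
proof
  show "somewhere_dense r B" if "somewhere_dense r A" "A \<subseteq> B" for r A B
    using that unfolding somewhere_dense_def by (meson subsetD)
  show "somewhere_dense r A" if "somewhere_dense (Suc r) A" for r A
    using that by (simp add: somewhere_dense_def)
  show "A \<noteq> {}" if "somewhere_dense (Suc r) A" for r A
    using that agree_refl unfolding somewhere_dense_def by blast
  show "somewhere_dense r (A \<inter> B) \<or> somewhere_dense r (A - B)"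
    if A: "somewhere_dense (r + r) A" for r A B
  proof (rule disjCI)
    obtain t k where tk: "\<And>u j. agree k t u \<Longrightarrow> \<exists>w\<in>A. agree j u w"
      using A unfolding somewhere_dense_def by blast
    assume "\<not> somewhere_dense r (A - B)"
    \<comment> \<open>\<open>A - B\<close> misses a cylinder in which \<open>A\<close> is dense, so
      there the density comes from \<open>A \<inter> B\<close>.\<close>
    then obtain u j where u: "agree k t u" "\<And>w. w \<in> A - B \<Longrightarrow> \<not> agree j u w"
      unfolding somewhere_dense_def by meson
    have "\<exists>w\<in>A \<inter> B. agree i v w" if v: "agree (max j k) u v" for v i
    proof -
      have "agree j u v" "agree k u v" using agree_mono[OF v] by auto
      moreover obtain w where w: "w \<in> A" "agree (max i j) v w"
        using tk agree_trans[OF u(1) \<open>agree k u v\<close>] by blast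
      moreover have "agree i v w" "agree j v w" using agree_mono[OF w(2)] by auto
      ultimately show ?thesis using u(2)[of w] agree_trans by blast
    qed
    then show "somewhere_dense r (A \<inter> B)" unfolding somewhere_dense_def by blast
  qed
  show "\<exists>Z. clopen Z \<and> Z \<inter> S = {} \<and> somewhere_dense r (A \<inter> Z)"
    if S: "sparse S" and A: "somewhere_dense (Suc r) A" for S r A
  proof -
    obtain t k where tk: "\<And>u j. agree k t u \<Longrightarrow> \<exists>w\<in>A. agree j u w"
      using A unfolding somewhere_dense_def by blast
    obtain u j where u: "agree k t u" "\<And>w. w \<in> S \<Longrightarrow> \<not> agree j u w"
      using S unfolding sparse_def by meson
    define Z where "Z = {w. agree (max j k) u w}"
    have "\<exists>w\<in>A \<inter> Z. agree i v w" if v: "agree (max j k) u v" for v i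
    proof -
      have "agree k u v" using agree_mono[OF v] by auto
      then obtain w where w: "w \<in> A" "agree (max i (max j k)) v w"
        using tk agree_trans[OF u(1)] by blast
      have "agree i v w" "agree (max j k) v w" using agree_mono[OF w(2)] by auto
      then show ?thesis using w(1) agree_trans[OF v] by (auto simp: Z_def)
    qed
    then have "somewhere_dense r (A \<inter> Z)" unfolding somewhere_dense_def by blast
    moreover have "Z \<inter> S = {}"
      using u(2) agree_mono[of "max j k" u _ j] by (auto simp: Z_def)
    ultimately show ?thesis by (intro exI[of _ Z]) (simp add: Z_def)
  qed
  show "somewhere_dense r UNIV" for r unfolding somewhere_dense_def using agree_refl by blast
  show "sparse {}" unfolding sparse_def using agree_refl by blast
qed

text \<open>Lets a nowhere dense selection be covered by a closed nowhere dense one, as the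
  criterion for failure demands.\<close>

lemma sparse_cl:
  assumes "sparse S"
  shows "sparse (cl S)"
  unfolding sparse_def
proof (intro allI)
  fix t k
  obtain u j where u: "agree k t u" "\<And>w. w \<in> S \<Longrightarrow> \<not> agree j u w"
    using assms unfolding sparse_def by meson
  have "\<not> agree j u w" if w: "w \<in> cl S" for w
  proof
    assume uw: "agree j u w"
    obtain v where "v \<in> S" "agree j w v" using w by (auto simp: cl_def)
    then show False using u(2) agree_trans[OF uw] by blast
  qed
  then show "\<exists>u j. agree k t u \<and> (\<forall>w\<in>cl S. \<not> agree j u w)" using u(1) by blast
qed

section \<open>The four spaces\<close>

lemma fin_SP_not_one_SP:
  assumes CH
  shows "\<exists>X :: real set topology. nice_space X \<and> fin_SP X \<and> \<not> one_SP X"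
proof -
  obtain Z p where "matrix_space numerous (\<lambda>S. \<exists>t. S \<subseteq> {t}) Z p"
    using largeness.matrix_space_exists[OF largeness_numerous assms] by blast
  then interpret matrix_space numerous "\<lambda>S. \<exists>t. S \<subseteq> {t}" Z p .
  have "fin_SP X"
    unfolding fin_SP_def
  proof (rule selectively_pseudocompactI)
    fix n t k r
    \<comment> \<open>Finite selections of growing size are allowed, while the avoided ones are
      singletons.\<close>
    have "card (spike k t ` {..<r}) = r"
      using inj_spike by (simp add: card_image inj_on_def)
    then show "\<exists>A. A \<subseteq> {u. agree k t u} \<inter> finite_support \<and> numerous r A \<and>
        col n ` A \<in> {A. A \<subseteq> topspace X \<and> finite A}"
      by (intro exI[of _ "spike k t ` {..<r}"]) (auto simp: numerous_def spike_finite_support)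
  qed simp
  moreover have "\<not> one_SP X"
    unfolding one_SP_def
  proof (rule not_selectively_pseudocompactI)
    fix A n assume A: "A \<in> {A. A \<subseteq> topspace X \<and> card A = 1}" "A \<subseteq> range (col n)"
    then obtain x where "A = {x}" by (auto simp: card_1_singleton_iff)
    then obtain t where "A = col n ` {t}" using A(2) by auto
    then show "\<exists>S. (\<exists>t. S \<subseteq> {t}) \<and> cantor_closed S \<and> A \<subseteq> col n ` S"
      using cantor_closed_finite[of "{t}"] by (intro exI[of _ "{t}"]) auto
  qed
  ultimately show ?thesis using nice_X by blast
qed

lemma ClScat_SP_not_fin_SP:
  assumes CH
  shows "\<exists>X :: real set topology. nice_space X \<and> ClScat_SP X \<and> \<not> fin_SP X"
proof -
  obtain Z p where "matrix_space ranked finite Z p"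
    using largeness.matrix_space_exists[OF largeness_ranked assms] by blast
  then interpret matrix_space ranked finite Z p .
  have "ClScat_SP X"
    unfolding ClScat_SP_def
  proof (rule selectively_pseudocompactI)
    fix n t
    show "{col n t} \<in> {A. closedin X A \<and> scattered_set X A}"
      using closedin_column_iff[of n "{t}"] scattered_column_iff[of n "{t}"]
      by (simp add: cantor_closed_finite thin_finite)
    fix k r
    have "few r k t \<subseteq> {u. agree k t u} \<inter> finite_support" using few_finite_support by (auto simp: few_def)
    then show "\<exists>A. A \<subseteq> {u. agree k t u} \<inter> finite_support \<and> ranked r A \<and>
        col n ` A \<in> {A. closedin X A \<and> scattered_set X A}"
      by (intro exI[of _ "few r k t"])
        (simp add: ranked_few closedin_column_iff scattered_column_iff cantor_closed_few thin_few)
  qed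
  moreover have "\<not> fin_SP X"
    unfolding fin_SP_def
  proof (rule not_selectively_pseudocompactI)
    fix A n assume A: "A \<in> {A. A \<subseteq> topspace X \<and> finite A}" "A \<subseteq> range (col n)"
    then obtain S where "finite S" "A = col n ` S"
      using finite_subset_image[of A "col n" UNIV] by auto
    then show "\<exists>S. finite S \<and> cantor_closed S \<and> A \<subseteq> col n ` S"
      using cantor_closed_finite by blast
  qed
  ultimately show ?thesis using nice_X by blast
qed

lemma Scat_SP_not_ClScat_SP:
  assumes CH
  shows "\<exists>X :: real set topology. nice_space X \<and> Scat_SP X \<and> \<not> ClScat_SP X"
proof -
  obtain Z p where "matrix_space fat (\<lambda>S. thin S \<and> cantor_closed S) Z p"
    using largeness.matrix_space_exists[OF largeness_fat assms] by blast
  then interpret matrix_space fat "\<lambda>S. thin S \<and> cantor_closed S" Z p .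
  have "Scat_SP X"
    unfolding Scat_SP_def
  proof (rule selectively_pseudocompactI)
    fix n t
    show "{col n t} \<in> {A. scattered_set X A}"
      using scattered_column_iff[of n "{t}"] by (simp add: thin_finite)
    fix k r
    have "hedge k t \<subseteq> {u. agree k t u} \<inter> finite_support" using hedge_finite_support by (auto simp: hedge_def)
    then show "\<exists>A. A \<subseteq> {u. agree k t u} \<inter> finite_support \<and> fat r A \<and> col n ` A \<in> {A. scattered_set X A}"
      by (intro exI[of _ "hedge k t"]) (simp add: fat_hedge scattered_column_iff thin_hedge)
  qed
  moreover have "\<not> ClScat_SP X"
    unfolding ClScat_SP_def
  proof (rule not_selectively_pseudocompactI)
    fix A n assume A: "A \<in> {A. closedin X A \<and> scattered_set X A}" "A \<subseteq> range (col n)"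
    then obtain S where S: "A = col n ` S" by (auto simp: subset_image_iff)
    then have "thin S" "cantor_closed S"
      using A(1) by (simp_all add: closedin_column_iff scattered_column_iff)
    then show "\<exists>S. (thin S \<and> cantor_closed S) \<and> cantor_closed S \<and> A \<subseteq> col n ` S"
      using S by blast
  qed
  ultimately show ?thesis using nice_X by blast
qed

lemma pseudocompact_not_Nwd_SP:
  assumes CH
  shows "\<exists>X :: real set topology. nice_space X \<and> pseudocompact X \<and> \<not> Nwd_SP X"
proof -
  obtain Z p where "matrix_space somewhere_dense sparse Z p"
    using largeness.matrix_space_exists[OF largeness_somewhere_dense assms] by blast
  then interpret matrix_space somewhere_dense sparse Z p .
  have "pseudocompact X"
  proof (rule pseudocompactI, rule selectively_pseudocompactI)
    fix n t k r
    show "\<exists>A. A \<subseteq> {u. agree k t u} \<inter> finite_support \<and> somewhere_dense r A \<and> col n ` A \<in> UNIV"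
      using somewhere_dense_finite_support by blast
  qed simp
  moreover have "\<not> Nwd_SP X"
    unfolding Nwd_SP_def
  proof (rule not_selectively_pseudocompactI)
    fix A n assume A: "A \<in> {A. nowhere_dense_in X A}" "A \<subseteq> range (col n)"
    then obtain S where S: "A = col n ` S" by (auto simp: subset_image_iff)
    then have "sparse (cl S)" using A(1) by (intro sparse_cl nowhere_dense_column) simp
    moreover have "A \<subseteq> col n ` cl S" unfolding S by (intro image_mono subset_cl)
    ultimately show "\<exists>S. sparse S \<and> cantor_closed S \<and> A \<subseteq> col n ` S"
      using cantor_closed_cl by blast
  qed
  ultimately show ?thesis using nice_X by blast
qed

theorem theorem1p5:
  assumes "CH"
  shows "\<exists>(X1::real set topology) (X2::real set topology) (X3::real set topology) (X4::real set topology).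
           nice_space X1 \<and> nice_space X2 \<and> nice_space X3 \<and> nice_space X4 \<and>
           (fin_SP X1 \<and> \<not> one_SP X1) \<and>
           (ClScat_SP X2 \<and> \<not> fin_SP X2) \<and>
           (Scat_SP X3 \<and> \<not> ClScat_SP X3) \<and>
           (pseudocompact X4 \<and> \<not> Nwd_SP X4)"
proof -
  obtain X1 :: "real set topology" where "nice_space X1" "fin_SP X1" "\<not> one_SP X1"
    using fin_SP_not_one_SP[OF assms] by blast
  moreover obtain X2 :: "real set topology" where "nice_space X2" "ClScat_SP X2" "\<not> fin_SP X2"
    using ClScat_SP_not_fin_SP[OF assms] by blast
  moreover obtain X3 :: "real set topology" where "nice_space X3" "Scat_SP X3" "\<not> ClScat_SP X3"
    using Scat_SP_not_ClScat_SP[OF assms] by blast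
  moreover obtain X4 :: "real set topology" where "nice_space X4" "pseudocompact X4" "\<not> Nwd_SP X4"
    using pseudocompact_not_Nwd_SP[OF assms] by blast
  ultimately show ?thesis
    by (intro exI[of _ X1] exI[of _ X2] exI[of _ X3] exI[of _ X4]) simp
qed

end
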